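(* Let $a$ be (WD) or (SD). Assume that $f:H^2_{\frac1a,0}(0,1)\to L^2_{\frac1a}(0,1)$ is continuous and satisfies: (1) $f(0)=0$; (2) for every $r>0$ there is a constant $L(r)>0$ such that $\|f(u)-f(v)\|_{L^2_{\frac1a}(0,1)}\le L(r)\|u''-v''\|_{L^2(0,1)}$ for all $u,v\in H^2_{\frac1a,0}(0,1)$ with $\|u''\|_{L^2(0,1)}\le r$, $\|v''\|_{L^2(0,1)}\le r$; (3) there is a strictly increasing continuous function $h:\mathbb{R}_+\to\mathbb{R}_+$ such that $\langle f(u),u\rangle_{L^2_{\frac1a}(0,1)}\le h(\|u''\|_{L^2(0,1)})\|u''\|^2_{L^2(0,1)}$ for all $u\in H^2_{\frac1a,0}(0,1)$. Assume further that: (a) there are constants $\alpha\ge0$, $\omega'\in[0,\omega)$ with $Mb^2e^{\omega\tau}\int_0^t|k(s+\tau)|ds\le\alpha+\omega' t$ for all $t>0$; (b) there are $T,\rho,C_\rho>0$ with $L(C_\rho)<\frac{\omega-\omega'}{M}$ such that, whenever $Y^0\in\mathcal{H}_0$ and $g:[-\tau,0]\to H$ satisfy $$\|Y^0\|^2_{\mathcal{H}_0}+\int_0^\tau|k(s)|\,\|g(s-\tau)\|_H^2\,ds<\rho^2,\qquad( * )$$ problem (P) (see context) has a unique solution $Y\in\mathcal{C}([0,T);\mathcal{H}_0)$, and it satisfies $\|Y(t)\|_{\mathcal{H}_0}\le C_\rho$ for all $t\in[0,T)$. Let the initial data $(Y^0,g)$ satisfy $( * )$. Then every solution $Y$ of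 (P) is such that $$\|Y(t)\|_{\mathcal{H}_0}\le Me^\alpha\Bigl(\|Y^0\|_{\mathcal{H}_0}+\int_0^\tau e^{\omega s}|k(s)|\,\|\psi(s-\tau)\|_{\mathcal{H}_0}ds\Bigr)e^{-(\omega-\omega'-ML(C_\rho))t}$$ for any $t\in[0,T)$.
   Context: Degeneracy. A function $a$ with $a(0)=0$, $a>0$ on $(0,1]$; put $K:=\sup_{x\in(0,1]}\frac{x|a'(x)|}{a(x)}$. $a$ is (WD) if $a\in\mathcal{C}[0,1]\cap\mathcal{C}^1(0,1]$ and $K\in(0,1)$; $a$ is (SD) if $a\in\mathcal{C}^1[0,1]$ and $K\in[1,2)$. Spaces. $L^2_{\frac1a}(0,1)=\{u\in L^2(0,1):\int_0^1\frac{u^2}{a}dx<\infty\}$ with $\langle u,v\rangle=\int_0^1\frac{uv}{a}dx$; $H^2_{\frac1a,0}(0,1)=\{u\in L^2_{\frac1a}(0,1)\cap H^2(0,1):u(0)=u'(0)=0\}$. With constants $\beta,\gamma\ge0$, $\mathcal{H}_0=H^2_{\frac1a,0}(0,1)\times L^2_{\frac1a}(0,1)$ has norm $\|(u,v)\|^2_{\mathcal{H}_0}=\int_0^1(u'')^2dx+\int_0^1\frac{v^2}{a}dx+\beta u^2(1)+\gamma(u'(1))^2$. Operator. $A_{nd}u=au''''$ on $D(A_{nd})=\{u\in H^2_{\frac1a,0}(0,1):au''''\in L^2_{\frac1a}(0,1)\}$; $\mathcal{A}_{nd}(u,v)=(v,-A_{nd}u)$ on $D(\mathcal{A}_{nd})=\{(u,v)\in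 D(A_{nd})\times H^2_{\frac1a,0}(0,1):\beta u(1)-u'''(1)+v(1)=0,\ \gamma u'(1)+u''(1)+v'(1)=0\}$. It generates a contraction $C_0$-semigroup $(S(t))_{t\ge0}$ on $\mathcal{H}_0$, which is known to be exponentially stable; $M,\omega>0$ denote fixed constants with $\|S(t)\|_{\mathcal{L}(\mathcal{H}_0)}\le Me^{-\omega t}$ for all $t\ge0$. Delayed problem. $\tau>0$; $k\in L^1_{loc}([-\tau,+\infty))$ with $\int_{t-\tau}^t|k(s)|ds\le\Lambda$ for all $t\ge0$ and some $\Lambda>0$; $H$ is a real Hilbert space, $B:H\to L^2_{\frac1a}(0,1)$ is bounded linear with adjoint $B^*$, $b:=\|B\|=\|B^*\|$, $g:[-\tau,0]\to H$. For $Y=(y,v)$ put $\mathcal{B}Y=(0,BB^*v)$, $\mathcal{F}(Y)=(0,f(y))$, and $\psi(s)=(0,Bg(s))$. Problem (P) is $$\dot Y(t)=\mathcal{A}_{nd}Y(t)-k(t)\mathcal{B}Y(t-\tau)+\mathcal{F}(Y(t)),\quad Y(0)=Y^0,\quad \mathcal{B}Y(s)=\psi(s),\ s\in[-\tau,0].$$ Solutions are understood in the mild sense: $Y$ is continuous with values in $\mathcal{H}_0$ and $Y(t)=S(t)Y^0-\int_0^tS(t-s)k(s)\mathcal{B}Y(s-\tau)ds+\int_0^tS(t-s)\mathcal{F}(Y(s))ds$, with $\mathcal{B}Y(s)=\psi(s)$ for $s\in[-\tau,0]$. *)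

theory Defs
  imports "HOL-Analysis.Analysis"
begin

section \<open>Degenerate coefficients\<close>

text \<open>Derivatives are taken within \<open>S\<close>, hence one-sided at endpoints belonging to \<open>S\<close>.\<close>

definition C1_on :: "real set \<Rightarrow> (real \<Rightarrow> real) \<Rightarrow> bool" where
  "C1_on S a \<longleftrightarrow> a differentiable_on S \<and>
     continuous_on S (\<lambda>x. vector_derivative a (at x within S))"

text \<open>Extended reals, so that the supremum of an unbounded set is \<open>\<infinity>\<close>.\<close>

definition deg_const :: "(real \<Rightarrow> real) \<Rightarrow> ereal" where
  "deg_const a = (SUP x\<in>{0<..1}. ereal (x * \<bar>vector_derivative a (at x within {0<..1})\<bar> / a x))"

definition WD :: "(real \<Rightarrow> real) \<Rightarrow> bool" where
  "WD a \<longleftrightarrow> a 0 = 0 \<and> (\<forall>x\<in>{0<..1}. a x > 0) \<and>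
     continuous_on {0..1} a \<and> C1_on {0<..1} a \<and> 0 < deg_const a \<and> deg_const a < 1"

definition SD :: "(real \<Rightarrow> real) \<Rightarrow> bool" where
  "SD a \<longleftrightarrow> a 0 = 0 \<and> (\<forall>x\<in>{0<..1}. a x > 0) \<and>
     C1_on {0..1} a \<and> 1 \<le> deg_const a \<and> deg_const a < 2"


section \<open>Classes of measurable functions on (0,1)\<close>

abbreviation leb01 :: "real measure" where
  "leb01 \<equiv> lebesgue_on {0<..<1}"

definition ae_eq01 :: "(real \<Rightarrow> real) \<Rightarrow> (real \<Rightarrow> real) \<Rightarrow> bool" where
  "ae_eq01 u v \<longleftrightarrow> u \<in> borel_measurable leb01 \<and> v \<in> borel_measurable leb01 \<and>
     (AE x in leb01. u x = v x)"

quotient_type aefun = "real \<Rightarrow> real" / partial: ae_eq01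
proof (rule part_equivpI)
  show "\<exists>u. ae_eq01 u u"
    by (rule exI[of _ "\<lambda>_. 0"]) (simp add: ae_eq01_def)
  show "symp ae_eq01"
    by (rule sympI) (auto simp: ae_eq01_def elim: eventually_mono)
  show "transp ae_eq01"
    by (rule transpI) (auto simp: ae_eq01_def elim: eventually_elim2)
qed

instantiation aefun :: real_vector
begin

lift_definition zero_aefun :: aefun is "\<lambda>_. 0"
  by (simp add: ae_eq01_def)

lift_definition plus_aefun :: "aefun \<Rightarrow> aefun \<Rightarrow> aefun" is "\<lambda>u v x. u x + v x"
  by (auto simp: ae_eq01_def elim: eventually_elim2)

lift_definition minus_aefun :: "aefun \<Rightarrow> aefun \<Rightarrow> aefun" is "\<lambda>u v x. u x - v x"
  by (auto simp: ae_eq01_def elim: eventually_elim2)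

lift_definition uminus_aefun :: "aefun \<Rightarrow> aefun" is "\<lambda>u x. - u x"
  by (auto simp: ae_eq01_def elim: eventually_mono)

lift_definition scaleR_aefun :: "real \<Rightarrow> aefun \<Rightarrow> aefun" is "\<lambda>c u x. c * u x"
  by (auto simp: ae_eq01_def elim: eventually_mono)

instance
  by standard (transfer; auto simp: ae_eq01_def algebra_simps)+

end

text \<open>In what follows \<open>rep_aefun u\<close> is some representative of the class \<open>u\<close>, and
  \<open>abs_aefun\<close> sends a measurable function to its class; nothing depends on the choice of the
  representative.\<close>

definition mult_fun :: "(real \<Rightarrow> real) \<Rightarrow> aefun \<Rightarrow> aefun" where
  "mult_fun a u = abs_aefun (\<lambda>x. a x * rep_aefun u x)"


section \<open>Weak derivatives and boundary values\<close>

definition loc_integrable01 :: "aefun \<Rightarrow> bool" where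
  "loc_integrable01 u \<longleftrightarrow>
     (\<forall>c d. 0 < c \<and> d < 1 \<longrightarrow> set_integrable lebesgue {c..d} (rep_aefun u))"

definition test_fun01 :: "(real \<Rightarrow> real) \<Rightarrow> bool" where
  "test_fun01 \<phi> \<longleftrightarrow> \<phi> C1_differentiable_on UNIV \<and>
     (\<exists>c d. 0 < c \<and> d < 1 \<and> (\<forall>x. x \<notin> {c..d} \<longrightarrow> \<phi> x = 0))"

definition has_weak_deriv :: "aefun \<Rightarrow> aefun \<Rightarrow> bool" where
  "has_weak_deriv u w \<longleftrightarrow> loc_integrable01 u \<and> loc_integrable01 w \<and>
     (\<forall>\<phi>. test_fun01 \<phi> \<longrightarrow>
        (LINT x|leb01. rep_aefun u x * deriv \<phi> x) = - (LINT x|leb01. rep_aefun w x * \<phi> x))"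

definition wderiv :: "aefun \<Rightarrow> aefun" where
  "wderiv u = (THE w. has_weak_deriv u w)"

text \<open>The value at an endpoint \<open>p\<close> of the representative that is continuous on the
  open interval and up to \<open>p\<close>.\<close>

definition bdry_val :: "aefun \<Rightarrow> real \<Rightarrow> real" where
  "bdry_val u p = (THE c. \<exists>w. continuous_on (insert p {0<..<1}) w \<and>
     (AE x in leb01. w x = rep_aefun u x) \<and> w p = c)"


section \<open>Function spaces\<close>

definition L2 :: "aefun set" where
  "L2 = {u. integrable leb01 (\<lambda>x. (rep_aefun u x)\<^sup>2)}"

definition L2_norm :: "aefun \<Rightarrow> real" where
  "L2_norm u = sqrt (LINT x|leb01. (rep_aefun u x)\<^sup>2)"

definition L2w :: "(real \<Rightarrow> real) \<Rightarrow> aefun set" where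
  "L2w a = {u \<in> L2. integrable leb01 (\<lambda>x. (rep_aefun u x)\<^sup>2 / a x)}"

definition L2w_inner :: "(real \<Rightarrow> real) \<Rightarrow> aefun \<Rightarrow> aefun \<Rightarrow> real" where
  "L2w_inner a u v = (LINT x|leb01. rep_aefun u x * rep_aefun v x / a x)"

definition L2w_norm :: "(real \<Rightarrow> real) \<Rightarrow> aefun \<Rightarrow> real" where
  "L2w_norm a u = sqrt (L2w_inner a u u)"

definition H2 :: "aefun set" where
  "H2 = {u \<in> L2. \<exists>u1\<in>L2. \<exists>u2\<in>L2. has_weak_deriv u u1 \<and> has_weak_deriv u1 u2}"

definition H2w0 :: "(real \<Rightarrow> real) \<Rightarrow> aefun set" where
  "H2w0 a = {u \<in> L2w a \<inter> H2. bdry_val u 0 = 0 \<and> bdry_val (wderiv u) 0 = 0}"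

definition H0 :: "(real \<Rightarrow> real) \<Rightarrow> (aefun \<times> aefun) set" where
  "H0 a = H2w0 a \<times> L2w a"

definition H0_norm :: "(real \<Rightarrow> real) \<Rightarrow> real \<Rightarrow> real \<Rightarrow> aefun \<times> aefun \<Rightarrow> real" where
  "H0_norm a \<beta> \<gamma> = (\<lambda>(u, v). sqrt (
     (LINT x|leb01. (rep_aefun ((wderiv ^^ 2) u) x)\<^sup>2) + (LINT x|leb01. (rep_aefun v x)\<^sup>2 / a x)
     + \<beta> * (bdry_val u 1)\<^sup>2 + \<gamma> * (bdry_val (wderiv u) 1)\<^sup>2))"


section \<open>The operators\<close>

definition A_nd :: "(real \<Rightarrow> real) \<Rightarrow> aefun \<Rightarrow> aefun" where
  "A_nd a u = mult_fun a ((wderiv ^^ 4) u)"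

definition dom_A_nd :: "(real \<Rightarrow> real) \<Rightarrow> aefun set" where
  "dom_A_nd a = {u \<in> H2w0 a.
     (\<exists>u3 u4. has_weak_deriv ((wderiv ^^ 2) u) u3 \<and> has_weak_deriv u3 u4) \<and> A_nd a u \<in> L2w a}"

definition calA_nd :: "(real \<Rightarrow> real) \<Rightarrow> aefun \<times> aefun \<Rightarrow> aefun \<times> aefun" where
  "calA_nd a = (\<lambda>(u, v). (v, - A_nd a u))"

definition dom_calA_nd :: "(real \<Rightarrow> real) \<Rightarrow> real \<Rightarrow> real \<Rightarrow> (aefun \<times> aefun) set" where
  "dom_calA_nd a \<beta> \<gamma> = {(u, v). u \<in> dom_A_nd a \<and> v \<in> H2w0 a \<and>
     \<beta> * bdry_val u 1 - bdry_val ((wderiv ^^ 3) u) 1 + bdry_val v 1 = 0 \<and>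
     \<gamma> * bdry_val (wderiv u) 1 + bdry_val ((wderiv ^^ 2) u) 1 + bdry_val (wderiv v) 1 = 0}"


section \<open>Linear operators, semigroups and Bochner integrals on a normed subspace\<close>

text \<open>The norms above depend on \<open>a\<close>, \<open>\<beta>\<close>, \<open>\<gamma>\<close> and so cannot be attached to a type; a normed
  space is therefore given by a subspace \<open>V\<close> of a real vector space with a norm \<open>N\<close> on \<open>V\<close>.\<close>

definition bounded_linear_on ::
  "'v::real_vector set \<Rightarrow> ('v \<Rightarrow> real) \<Rightarrow> 'w::real_vector set \<Rightarrow> ('w \<Rightarrow> real) \<Rightarrow> ('v \<Rightarrow> 'w) \<Rightarrow> bool"
  where
  "bounded_linear_on V N W N' F \<longleftrightarrow> (\<forall>x\<in>V. F x \<in> W) \<and>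
     (\<forall>x\<in>V. \<forall>y\<in>V. F (x + y) = F x + F y) \<and> (\<forall>c. \<forall>x\<in>V. F (c *\<^sub>R x) = c *\<^sub>R F x) \<and>
     (\<exists>C. \<forall>x\<in>V. N' (F x) \<le> C * N x)"

definition onorm_on :: "'v set \<Rightarrow> ('v \<Rightarrow> real) \<Rightarrow> ('w \<Rightarrow> real) \<Rightarrow> ('v \<Rightarrow> 'w) \<Rightarrow> real" where
  "onorm_on V N N' F = (SUP x\<in>V. N' (F x) / N x)"

definition C0_semigroup_on ::
  "'v::real_vector set \<Rightarrow> ('v \<Rightarrow> real) \<Rightarrow> (real \<Rightarrow> 'v \<Rightarrow> 'v) \<Rightarrow> bool" where
  "C0_semigroup_on V N S \<longleftrightarrow>
     (\<forall>t\<ge>0. bounded_linear_on V N V N (S t)) \<and> (\<forall>x\<in>V. S 0 x = x) \<and>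
     (\<forall>s\<ge>0. \<forall>t\<ge>0. \<forall>x\<in>V. S (s + t) x = S s (S t x)) \<and>
     (\<forall>x\<in>V. ((\<lambda>t. N (S t x - x)) \<longlongrightarrow> 0) (at_right 0))"

definition contraction_C0_semigroup_on ::
  "'v::real_vector set \<Rightarrow> ('v \<Rightarrow> real) \<Rightarrow> (real \<Rightarrow> 'v \<Rightarrow> 'v) \<Rightarrow> bool" where
  "contraction_C0_semigroup_on V N S \<longleftrightarrow>
     C0_semigroup_on V N S \<and> (\<forall>t\<ge>0. onorm_on V N N (S t) \<le> 1)"

definition is_generator_on ::
  "'v::real_vector set \<Rightarrow> ('v \<Rightarrow> real) \<Rightarrow> (real \<Rightarrow> 'v \<Rightarrow> 'v) \<Rightarrow> 'v set \<Rightarrow> ('v \<Rightarrow> 'v) \<Rightarrow> bool" where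
  "is_generator_on V N S D A \<longleftrightarrow> D \<subseteq> V \<and> A ` D \<subseteq> V \<and>
     (\<forall>x\<in>V. \<forall>y\<in>V.
        ((\<lambda>t. N ((S t x - x) /\<^sub>R t - y)) \<longlongrightarrow> 0) (at_right 0) \<longleftrightarrow> x \<in> D \<and> y = A x)"

text \<open>The counterpart of \<^const>\<open>has_bochner_integral\<close> for the norm \<open>N\<close>; measurability of the
  norm differences together with the convergence makes \<open>F\<close> strongly measurable.\<close>

definition has_bochner_integral_on ::
  "'v::real_vector set \<Rightarrow> ('v \<Rightarrow> real) \<Rightarrow> 'a measure \<Rightarrow> ('a \<Rightarrow> 'v) \<Rightarrow> 'v \<Rightarrow> bool" where
  "has_bochner_integral_on V N M F z \<longleftrightarrow> (\<forall>x\<in>space M. F x \<in> V) \<and> z \<in> V \<and>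
     (\<exists>s. (\<forall>i. Bochner_Integration.simple_bochner_integrable M (s i) \<and> s i ` space M \<subseteq> V \<and>
               (\<lambda>x. N (F x - s i x)) \<in> borel_measurable M) \<and>
          (\<lambda>i. \<integral>\<^sup>+x. ennreal (N (F x - s i x)) \<partial>M) \<longlonglongrightarrow> 0 \<and>
          (\<lambda>i. N (Bochner_Integration.simple_bochner_integral M (s i) - z)) \<longlonglongrightarrow> 0)"

definition strongly_measurable_on :: "real set \<Rightarrow> (real \<Rightarrow> 'h::topological_space) \<Rightarrow> bool" where
  "strongly_measurable_on I g \<longleftrightarrow>
     (\<exists>s. (\<forall>i::nat. simple_function (lebesgue_on I) (s i)) \<and>
          (AE x in lebesgue_on I. (\<lambda>i. s i x) \<longlonglongrightarrow> g x))"


section \<open>The delayed problem\<close>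

definition is_adjoint :: "(real \<Rightarrow> real) \<Rightarrow> ('h::real_inner \<Rightarrow> aefun) \<Rightarrow> (aefun \<Rightarrow> 'h) \<Rightarrow> bool" where
  "is_adjoint a B Bs \<longleftrightarrow> (\<forall>x. \<forall>u\<in>L2w a. L2w_inner a (B x) u = x \<bullet> Bs u)"

definition calB :: "('h \<Rightarrow> aefun) \<Rightarrow> (aefun \<Rightarrow> 'h) \<Rightarrow> aefun \<times> aefun \<Rightarrow> aefun \<times> aefun" where
  "calB B Bs Y = (0, B (Bs (snd Y)))"

definition calF :: "(aefun \<Rightarrow> aefun) \<Rightarrow> aefun \<times> aefun \<Rightarrow> aefun \<times> aefun" where
  "calF f Y = (0, f (fst Y))"

definition psi :: "('h \<Rightarrow> aefun) \<Rightarrow> (real \<Rightarrow> 'h) \<Rightarrow> real \<Rightarrow> aefun \<times> aefun" where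
  "psi B g s = (0, B (g s))"

text \<open>The function \<open>s \<mapsto> \<B>Y(s)\<close> on \<open>[-\<tau>,\<infinity>)\<close>, prescribed to be \<open>\<psi>\<close> on \<open>[-\<tau>,0]\<close>. No compatibility
  between \<open>g(0)\<close> and \<open>Y(0)\<close> is imposed; the value at the single point 0 does not affect the
  mild formulation.\<close>

definition calB_hist ::
  "('h \<Rightarrow> aefun) \<Rightarrow> (aefun \<Rightarrow> 'h) \<Rightarrow> (real \<Rightarrow> 'h) \<Rightarrow> (real \<Rightarrow> aefun \<times> aefun) \<Rightarrow> real \<Rightarrow> aefun \<times> aefun"
  where
  "calB_hist B Bs g Y s = (if s \<le> 0 then psi B g s else calB B Bs (Y s))"

definition mild_solution ::
  "(real \<Rightarrow> real) \<Rightarrow> real \<Rightarrow> real \<Rightarrow> (real \<Rightarrow> aefun \<times> aefun \<Rightarrow> aefun \<times> aefun) \<Rightarrow> real \<Rightarrow>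
   (real \<Rightarrow> real) \<Rightarrow> ('h \<Rightarrow> aefun) \<Rightarrow> (aefun \<Rightarrow> 'h) \<Rightarrow> (aefun \<Rightarrow> aefun) \<Rightarrow>
   aefun \<times> aefun \<Rightarrow> (real \<Rightarrow> 'h) \<Rightarrow> real \<Rightarrow> (real \<Rightarrow> aefun \<times> aefun) \<Rightarrow> bool" where
  "mild_solution a \<beta> \<gamma> S \<tau> k B Bs f Y0 g T Y \<longleftrightarrow>
     (\<forall>t\<in>{0..<T}. Y t \<in> H0 a \<and>
        ((\<lambda>s. H0_norm a \<beta> \<gamma> (Y s - Y t)) \<longlongrightarrow> 0) (at t within {0..<T})) \<and>
     (\<forall>t\<in>{0..<T}. \<exists>I J.
        has_bochner_integral_on (H0 a) (H0_norm a \<beta> \<gamma>) (lebesgue_on {0..t})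
          (\<lambda>s. S (t - s) (k s *\<^sub>R calB_hist B Bs g Y (s - \<tau>))) I \<and>
        has_bochner_integral_on (H0 a) (H0_norm a \<beta> \<gamma>) (lebesgue_on {0..t})
          (\<lambda>s. S (t - s) (calF f (Y s))) J \<and>
        Y t = S t Y0 - I + J)"

text \<open>The condition (*) on the initial data, including measurability and integrability.\<close>

definition small_data ::
  "(real \<Rightarrow> real) \<Rightarrow> real \<Rightarrow> real \<Rightarrow> real \<Rightarrow> (real \<Rightarrow> real) \<Rightarrow> real \<Rightarrow>
   aefun \<times> aefun \<Rightarrow> (real \<Rightarrow> 'h::real_normed_vector) \<Rightarrow> bool" where
  "small_data a \<beta> \<gamma> \<tau> k \<rho> Y0 g \<longleftrightarrow> Y0 \<in> H0 a \<and>
     strongly_measurable_on {-\<tau>..0} g \<and>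
     set_integrable lebesgue {0..\<tau>} (\<lambda>s. \<bar>k s\<bar> * (norm (g (s - \<tau>)))\<^sup>2) \<and>
     (H0_norm a \<beta> \<gamma> Y0)\<^sup>2 + (LINT s:{0..\<tau>}|lebesgue. \<bar>k s\<bar> * (norm (g (s - \<tau>)))\<^sup>2) < \<rho>\<^sup>2"

end

theory Submission
  imports Defs
begin

text \<open>The initial data satisfy the smallness condition, so by uniqueness every mild solution stays in the
  ball of radius \<open>C\<rho>\<close>, where \<open>f\<close> is Lipschitz with constant \<open>L C\<rho>\<close> and vanishes at \<open>0\<close>. Taking norms
  in Duhamel's formula, \<open>\<phi> t = exp (\<omega> * t) * \<parallel>Y t\<parallel>\<close> satisfies the integral inequality
  \<open>\<phi> t \<le> A + \<integral>\<^sub>0\<^sup>t \<kappa> \<phi>\<close> with the merely integrable kernel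
  \<open>\<kappa> s = M * b\<^sup>2 * exp (\<omega> * \<tau>) * \<bar>k (s + \<tau>)\<bar> + M * L C\<rho>\<close>, and Gronwall's inequality applies.
  For the triangle inequality of the norm one has to know that weak derivatives are unique and that
  functions with a square integrable weak derivative are continuous up to the boundary; both come from the
  du Bois-Reymond lemma.\<close>

text \<open>\<open>H0_norm\<close> is built from \<open>wderiv\<close> and \<open>bdry_val\<close>,
  both definite descriptions. They are linear only where the described object is known to exist and
  to be unique, and this is what brings Sobolev theory into a statement about mild solutions. The
  kernel comes from splitting the memory integral at \<open>\<tau>\<close>. Up to
  \<open>\<tau>\<close> the history is the given \<psi>, which contributes a constant to
  \<open>A\<close>. Beyond \<open>\<tau>\<close>, replacing s by s + \<tau> turns the weighted term
  exp(\<omega> s) |k(s)| ||Y(s - \<tau>)|| into exp(\<omega> \<tau>) |k(s + \<tau>)| \<phi>(s), and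
  B with its adjoint costs the factor b squared. Hypothesis (a) bounds the mass of exactly this part
  by \<alpha> + \<omega>' t; the nonlinearity adds M L(C\<rho>) t, and removing the weight
  exp(\<omega> t) leaves the stated rate. As k is only locally integrable, the primitive of the
  kernel is differentiable merely almost everywhere; Gronwall's inequality is therefore proved by
  comparing finite increments. The Bochner integral with respect to \<open>N\<close> is given by
  approximation with simple functions, so the norm estimate for it is derived from that
  definition.\<close>

section \<open>The du Bois-Reymond lemma and primitives of weak derivatives\<close>

text \<open>The Borel sets over which the integral vanishes contain the compact intervals and are
  closed under complements, which is where \<open>total\<close> enters, and under countable disjoint
  unions. Hence they are all Borel sets and the density is null. As this induction concerns Borel
  sets, \<open>w\<close> is first replaced by an almost everywhere equal Borel function
  \<open>v\<close>.\<close>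

lemma AE_zero_if_interval_integrals_zero:
  fixes w :: "real \<Rightarrow> real"
  assumes w: "integrable lebesgue w"
    and total: "(LINT x|lebesgue. w x) = 0"
    and Icc: "\<And>p q. p \<le> q \<Longrightarrow> (LINT x:{p..q}|lebesgue. w x) = 0"
  shows "AE x in lebesgue. w x = 0"
proof -
  obtain v where v[measurable]: "v \<in> borel_measurable lborel" and wv: "AE x in lborel. w x = v x"
    using completion_ex_borel_measurable_real[of w lborel] w by auto
  have wv': "AE x in lebesgue. w x = v x"
    using wv by (simp add: AE_completion_iff)
  have "integrable lebesgue v"
    using w by (rule Bochner_Integration.integrable_cong_AE_imp) (use wv' in \<open>auto simp: eq_commute measurable_completion\<close>)
  then have iv: "integrable lborel v"
    by (simp add: integrable_completion)
  have eq: "(LINT x:A|lborel. v x) = (LINT x:A|lebesgue. w x)" if [measurable]: "A \<in> sets borel" for A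
  proof -
    have "(LINT x:A|lborel. v x) = (LINT x:A|lebesgue. v x)"
      unfolding set_lebesgue_integral_def by (intro integral_completion[symmetric]) auto
    also have "\<dots> = (LINT x:A|lebesgue. w x)"
      unfolding set_lebesgue_integral_def
    proof (rule integral_cong_AE)
      show "(\<lambda>x. indicat_real A x *\<^sub>R v x) \<in> borel_measurable lebesgue"
        by (rule measurable_completion) simp
      show "(\<lambda>x. indicat_real A x *\<^sub>R w x) \<in> borel_measurable lebesgue"
        using w by (intro borel_measurable_scaleR borel_measurable_indicator) auto
    qed (use wv' in \<open>auto elim: eventually_mono\<close>)
    finally show ?thesis .
  qed
  have total': "(LINT x|lborel. v x) = 0"
    using eq[of UNIV] total by (simp add: set_lebesgue_integral_def)
  have si: "set_integrable lborel A v" if "A \<in> sets borel" for A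
    using integrable_mult_indicator[OF _ iv, of A] that by (simp add: set_integrable_def)
  have "(LINT x:A|lborel. v x) = 0" if "A \<in> sets borel" for A
    using that
  proof (induction rule: borel_set_induct)
    case (interval a b)
    then show ?case using eq[of "{a..b}"] Icc[of a b] by simp
  next
    case (compl A)
    have "(LINT x:-A|lborel. v x) = (LINT x|lborel. v x) - (LINT x:A|lborel. v x)"
      unfolding set_lebesgue_integral_def
      by (subst Bochner_Integration.integral_diff[OF iv si[OF compl(1), unfolded set_integrable_def], symmetric])
        (auto simp: indicator_def of_bool_def intro!: Bochner_Integration.integral_cong)
    then show ?case using compl total' by simp
  next
    case (union f)
    have "(LINT x:(\<Union>i. f i)|lborel. v x) = (\<Sum>i. (LINT x:(f i)|lborel. v x))"
      using union(1,2) by (intro lebesgue_integral_countable_add si) (auto simp: disjoint_family_on_def)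
    then show ?case using union by simp
  qed (simp add: set_lebesgue_integral_def)
  then have "AE x in lborel. v x = (\<lambda>_. 0) x"
    by (intro density_unique_real iv) auto
  then show ?thesis
    using wv by (auto simp: AE_completion_iff elim: eventually_elim2)
qed

section \<open>Test functions and explicit bumps\<close>

lemma test_fun01_continuous_deriv:
  assumes "test_fun01 \<phi>"
  shows "(\<phi> has_real_derivative deriv \<phi> x) (at x)" "continuous_on UNIV (deriv \<phi>)"
    "continuous_on UNIV \<phi>"
proof -
  obtain D where D: "\<And>x. (\<phi> has_vector_derivative D x) (at x)" "continuous_on UNIV D"
    using assms by (auto simp: test_fun01_def C1_differentiable_on_def)
  have D': "(\<phi> has_real_derivative D x) (at x)" for x
    using D(1) by (simp add: has_real_derivative_iff_has_vector_derivative)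
  have "deriv \<phi> = D" by (rule ext) (rule DERIV_imp_deriv[OF D'])
  then show "(\<phi> has_real_derivative deriv \<phi> x) (at x)" "continuous_on UNIV (deriv \<phi>)"
    using D D' by auto
  show "continuous_on UNIV \<phi>"
    using D' by (auto intro!: DERIV_isCont continuous_at_imp_continuous_on)
qed

lemma test_fun01_support:
  assumes "test_fun01 \<phi>"
  obtains c d where "0 < c" "c < d" "d < 1" "\<And>x. x \<notin> {c..d} \<Longrightarrow> \<phi> x = 0" "\<And>x. x \<notin> {c..d} \<Longrightarrow> deriv \<phi> x = 0"
proof -
  obtain c d where cd: "0 < c" "d < 1" "\<And>x. x \<notin> {c..d} \<Longrightarrow> \<phi> x = 0"
    using assms by (auto simp: test_fun01_def)
  \<comment> \<open>For the zero function the interval {c..d} may be empty; including 1/3 and 2/3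
    makes it nondegenerate.\<close>
  define c' where "c' = min c (1/3)"
  define d' where "d' = max d (2/3)"
  have cd'1: "0 < c'" "c' < d'" "d' < 1"
    unfolding c'_def d'_def using cd(1,2) by auto
  have cd'2: "\<phi> x = 0" if "x \<notin> {c'..d'}" for x
    by (rule cd(3)) (use that in \<open>auto simp: c'_def d'_def\<close>)
  note cd' = cd'1 cd'2
  have "deriv \<phi> x = 0" if "x \<notin> {c'..d'}" for x
  proof -
    have "open (- {c'..d'})" "x \<in> - {c'..d'}" using that by auto
    then have "((\<lambda>_. 0) has_real_derivative 0) (at x)
      \<longleftrightarrow> (\<phi> has_real_derivative 0) (at x)"
      using cd'(4)
      by (intro DERIV_cong_ev refl) (auto simp: eventually_nhds intro!: exI[of _ "- {c'..d'}"])
    then show ?thesis by (intro DERIV_imp_deriv) auto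
  qed
  with cd' that show ?thesis by blast
qed

text \<open>Squaring the positive part removes its kink at 0, which is all the regularity that a C1
  test function requires.\<close>

lemma bump_has_derivative:
  "((\<lambda>y. (max 0 y)\<^sup>2) has_real_derivative 2 * max 0 y) (at (y::real))"
proof -
  consider "y < 0" | "y > 0" | "y = 0" by linarith
  then show ?thesis
  proof cases
    case 1
    then have "((\<lambda>_. 0) has_real_derivative 2 * max 0 y) (at y)" by simp
    then show ?thesis
      by (rule has_field_derivative_transform_within_open[of _ _ _ "{..<0}"]) (use 1 in auto)
  next
    case 2
    then have "((\<lambda>y. y\<^sup>2) has_real_derivative 2 * max 0 y) (at y)"
      by (auto intro!: derivative_eq_intros)
    then show ?thesis
      by (rule has_field_derivative_transform_within_open[of _ _ _ "{0<..}"]) (use 2 in auto)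
  next
    case 3
    have "((\<lambda>h::real. (max 0 h)\<^sup>2 / h) \<longlongrightarrow> 0) (at 0)"
    proof (rule Lim_null_comparison)
      show "\<forall>\<^sub>F h in at 0. norm ((max 0 h)\<^sup>2 / h) \<le> \<bar>h::real\<bar>"
        by (rule always_eventually) (auto simp: max_def power2_eq_square)
      show "((\<lambda>h::real. \<bar>h\<bar>) \<longlongrightarrow> 0) (at 0)"
        by (auto intro!: tendsto_eq_intros)
    qed
    then show ?thesis using 3 by (simp add: DERIV_def)
  qed
qed

text \<open>A rational substitute for a mollified indicator: with z the squared positive part, 1 -
  1/(1 + n z) lies in [0,1], vanishes where z = 0 and tends to 1 where z > 0. As n grows, the bumps
  converge pointwise to the indicator of {p<..<q}.\<close>

lemma test_fun01_bump:
  assumes "0 < p" "p \<le> q" "q < 1" "n \<ge> 0"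
  shows "test_fun01 (\<lambda>x. 1 - 1 / (1 + n * (max 0 ((x - p) * (q - x)))\<^sup>2))"
    (is "test_fun01 ?\<phi>")
proof -
  let ?r = "\<lambda>x. (x - p) * (q - x)"
  let ?D = "\<lambda>x. n * (2 * max 0 (?r x) * (p + q - 2 * x)) / (1 + n * (max 0 (?r x))\<^sup>2)\<^sup>2"
  have pos: "1 + n * (max 0 y)\<^sup>2 > 0" for y :: real
    using assms by (simp add: add_pos_nonneg)
  have 1: "((\<lambda>x. (max 0 (?r x))\<^sup>2) has_real_derivative 2 * max 0 (?r x) * (p + q - 2 * x)) (at x)" for x
    by (rule DERIV_chain2[OF bump_has_derivative]) (auto intro!: derivative_eq_intros)
  have "((\<lambda>x. 1 - 1 / (1 + n * G x)) has_real_derivative n * D / (1 + n * G x)\<^sup>2) (at x)"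
    if "(G has_real_derivative D) (at x)" "1 + n * G x > 0" for G D and x :: real
    using that by (auto intro!: derivative_eq_intros simp: power2_eq_square)
  from this[OF 1 pos] have "(?\<phi> has_real_derivative ?D x) (at x)" for x .
  then have "(?\<phi> has_vector_derivative ?D x) (at x)" for x
    by (simp add: has_real_derivative_iff_has_vector_derivative)
  moreover have "continuous_on UNIV ?D"
    using pos by (intro continuous_intros) (auto simp: less_imp_neq[THEN not_sym])
  ultimately have "?\<phi> C1_differentiable_on UNIV"
    unfolding C1_differentiable_on_def by (intro exI[of _ ?D]) auto
  moreover have "?\<phi> x = 0" if "x \<notin> {p..q}" for x
  proof -
    have "?r x \<le> 0" using that assms(2) by (auto simp: mult_le_0_iff)
    then show ?thesis by (simp add: max_def)
  qed
  ultimately show ?thesis using assms unfolding test_fun01_def by blast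
qed

text \<open>Testing with the bumps and letting n tend to infinity shows that \<open>w\<close> has
  integral 0 over every compact subinterval of (0,1); the interval lemma then applies to the
  truncations of \<open>w\<close>.\<close>

lemma du_Bois_Reymond_zero:
  fixes w :: "real \<Rightarrow> real"
  assumes loc: "\<And>c d. 0 < c \<Longrightarrow> d < 1 \<Longrightarrow> set_integrable lebesgue {c..d} w"
    and test: "\<And>\<phi>. test_fun01 \<phi> \<Longrightarrow> (LINT x|leb01. w x * \<phi> x) = 0"
  shows "AE x in leb01. w x = 0"
proof -
  have Icc: "(LINT x:{p..q}|lebesgue. w x) = 0" if pq: "0 < p" "q < 1" for p q
  proof (cases "p \<le> q")
    case False
    then show ?thesis by (simp add: set_lebesgue_integral_def)
  next
    case True
    define \<phi> where "\<phi> n x = 1 - 1 / (1 + real n * (max 0 ((x - p) * (q - x)))\<^sup>2)" for n x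
    have tf: "test_fun01 (\<phi> n)" for n
      unfolding \<phi>_def using pq True by (intro test_fun01_bump) auto
    have cont[measurable]: "\<phi> n \<in> borel_measurable borel" for n
      using test_fun01_continuous_deriv(3)[OF tf] by (rule borel_measurable_continuous_onI)
    have supp: "\<phi> n x = 0" if "x \<notin> {p<..<q}" for n x
    proof -
      have "(x - p) * (q - x) \<le> 0"
        using that True by (cases "p < x"; cases "x < q") (auto simp: mult_le_0_iff)
      then show ?thesis by (simp add: \<phi>_def max_def)
    qed
    have bd: "\<bar>\<phi> n x\<bar> \<le> 1" for n x
    proof -
      have "1 \<le> 1 + real n * (max 0 ((x - p) * (q - x)))\<^sup>2" by simp
      then have "0 \<le> 1 / (1 + real n * (max 0 ((x - p) * (q - x)))\<^sup>2)"
        "1 / (1 + real n * (max 0 ((x - p) * (q - x)))\<^sup>2) \<le> 1" by (auto simp: divide_le_eq)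
      moreover have "\<bar>1 - z\<bar> \<le> 1" if "0 \<le> z" "z \<le> 1" for z :: real using that by auto
      ultimately show ?thesis unfolding \<phi>_def by blast
    qed
    have lim: "(\<lambda>n. \<phi> n x) \<longlonglongrightarrow> indicator {p<..<q} x" for x
    proof (cases "x \<in> {p<..<q}")
      assume x: "x \<in> {p<..<q}"
      then have "(x - p) * (q - x) > 0" by simp
      then have "(max 0 ((x - p) * (q - x)))\<^sup>2 > 0"
        by (intro zero_less_power) (simp only: less_max_iff_disj simp_thms)
      then have "(\<lambda>n. 1 / (1 + real n * (max 0 ((x - p) * (q - x)))\<^sup>2)) \<longlonglongrightarrow> 0"
        by (intro tendsto_divide_0[OF tendsto_const] filterlim_at_top_imp_at_infinity
            filterlim_tendsto_add_at_top[OF tendsto_const]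
            filterlim_at_top_mult_tendsto_pos[OF tendsto_const] filterlim_real_sequentially)
      then have "(\<lambda>n. \<phi> n x) \<longlonglongrightarrow> 1 - 0"
        unfolding \<phi>_def by (intro tendsto_diff tendsto_const)
      then show ?thesis using x by simp
    next
      assume "x \<notin> {p<..<q}" then show ?thesis using supp by simp
    qed
    \<comment> \<open>Since \<open>w\<close> is only locally integrable, the cut-off supplies the
      dominating function. It does not change the tested integrals, because the bumps vanish off
      {p<..<q}.\<close>
    have int: "integrable lebesgue (\<lambda>x. indicator {p..q} x * w x)"
      using loc[OF pq] by (simp add: set_integrable_def)
    have z: "(LINT x|lebesgue. indicator {p..q} x * w x * \<phi> n x) = 0" for n
    proof -
      have "indicator {p..q} x * w x * \<phi> n x = indicator {0<..<1} x *\<^sub>R (w x * \<phi> n x)" for x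
        using pq supp[of x n] by (cases "x \<in> {p<..<q}") auto
      then have "(LINT x|lebesgue. indicator {p..q} x * w x * \<phi> n x) = (LINT x|leb01. w x * \<phi> n x)"
        by (subst integral_restrict_space) (simp_all only: space_completion space_lborel sets.top Int_UNIV_right, auto)
      then show ?thesis using test[OF tf] by simp
    qed
    have "(\<lambda>n. LINT x|lebesgue. indicator {p..q} x * w x * \<phi> n x) \<longlonglongrightarrow>
        (LINT x|lebesgue. indicator {p..q} x * w x * indicator {p<..<q} x)"
    proof (rule integral_dominated_convergence[where w="\<lambda>x. \<bar>indicator {p..q} x * w x\<bar>"])
      show "integrable lebesgue (\<lambda>x. \<bar>indicator {p..q} x * w x\<bar>)" using int by (rule integrable_abs)
      show "AE x in lebesgue. norm (indicator {p..q} x * w x * \<phi> n x) \<le> \<bar>indicator {p..q} x * w x\<bar>" for n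
        using bd by (intro always_eventually allI) (auto simp: abs_mult intro!: mult_left_le)
      show "(\<lambda>x. indicator {p..q} x * w x * indicator {p<..<q} x) \<in> borel_measurable lebesgue"
        by (rule borel_measurable_times[OF borel_measurable_integrable[OF int] borel_measurable_indicator]) auto
      show "(\<lambda>x. indicator {p..q} x * w x * \<phi> n x) \<in> borel_measurable lebesgue" for n
        by (rule borel_measurable_times[OF borel_measurable_integrable[OF int] measurable_completion]) simp
    qed (use lim in \<open>auto intro!: always_eventually tendsto_mult\<close>)
    then have "(LINT x|lebesgue. indicator {p..q} x * w x * indicator {p<..<q} x) = 0"
      by (simp add: z LIMSEQ_const_iff)
    also have "(LINT x|lebesgue. indicator {p..q} x * w x * indicator {p<..<q} x)
        = (LINT x|lebesgue. indicator {p..q} x * w x)"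
    proof (rule integral_cong_AE)
      \<comment> \<open>The bumps converge to the indicator of the open interval; the two endpoints
        are a null set.\<close>
      have "AE x in lebesgue. x \<notin> {p, q}"
        by (rule AE_not_in) (simp add: finite_imp_null_set_lborel null_sets_completionI)
      then show "AE x in lebesgue. indicator {p..q} x * w x * indicator {p<..<q} x = indicator {p..q} x * w x"
        by (rule eventually_mono) (auto simp: indicator_def)
      show "(\<lambda>x. indicator {p..q} x * w x * indicator {p<..<q} x) \<in> borel_measurable lebesgue"
        by (rule borel_measurable_times[OF borel_measurable_integrable[OF int] borel_measurable_indicator]) auto
    qed (use int in auto)
    finally show ?thesis by (simp add: set_lebesgue_integral_def)
  qed
  have AEcd: "AE x in lebesgue. x \<in> {c..d} \<longrightarrow> w x = 0" if cd: "0 < c" "d < 1" for c d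
  proof -
    have "AE x in lebesgue. indicator {c..d} x * w x = 0"
    proof (rule AE_zero_if_interval_integrals_zero)
      show "integrable lebesgue (\<lambda>x. indicator {c..d} x * w x)"
        using loc[OF cd] by (simp add: set_integrable_def)
      show "(LINT x|lebesgue. indicator {c..d} x * w x) = 0"
        using Icc[OF cd] by (simp add: set_lebesgue_integral_def)
      fix p q :: real
      \<comment> \<open>Truncation replaces {p..q} by its intersection with {c..d}. This may be
        empty, which is why \<open>Icc\<close> is stated without p \<le> q.\<close>
      have "(LINT x:{p..q}|lebesgue. indicator {c..d} x * w x) = (LINT x:{max p c..min q d}|lebesgue. w x)"
        unfolding set_lebesgue_integral_def
        by (intro Bochner_Integration.integral_cong) (auto simp: indicator_def)
      also have "\<dots> = 0" using cd by (intro Icc) auto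
      finally show "(LINT x:{p..q}|lebesgue. indicator {c..d} x * w x) = 0" .
    qed
    then show ?thesis by (rule eventually_mono) (auto simp: indicator_def)
  qed
  \<comment> \<open>Countably many compact intervals exhaust (0,1), so their exceptional sets merge
    into a single null set.\<close>
  have "AE x in lebesgue. \<forall>n::nat. x \<in> {1 / real (n + 2)..1 - 1 / real (n + 2)} \<longrightarrow> w x = 0"
    unfolding AE_all_countable by (intro allI AEcd) auto
  then have "AE x in lebesgue. x \<in> {0<..<1} \<longrightarrow> w x = 0"
  proof (rule eventually_mono, intro impI)
    fix x :: real
    assume *: "\<forall>n::nat. x \<in> {1 / real (n + 2)..1 - 1 / real (n + 2)} \<longrightarrow> w x = 0" and x: "x \<in> {0<..<1}"
    then obtain n where n: "n > 0" "inverse (real n) < min x (1 - x)"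
      using ex_inverse_of_nat_less[of "min x (1 - x)"] by auto
    have "1 / real (n + 2) \<le> inverse (real n)" using n by (simp add: field_simps)
    then have "x \<in> {1 / real (n + 2)..1 - 1 / real (n + 2)}" using n(2) by auto
    with * show "w x = 0" by blast
  qed
  then show ?thesis by (subst AE_restrict_space_iff) auto
qed

text \<open>Zero mean makes the primitive vanish again to the right of the support. Among continuous
  functions with compact support in (0,1), this condition singles out the derivatives of test
  functions.\<close>

lemma test_fun01_antiderivative:
  assumes \<zeta>: "continuous_on UNIV \<zeta>" and cd: "0 < c" "d < 1" "\<And>x. x \<notin> {c..d} \<Longrightarrow> \<zeta> x = 0"
    and int0: "integral {0..1} \<zeta> = 0"
  shows "test_fun01 (\<lambda>x. integral {0..x} \<zeta>)" "deriv (\<lambda>x. integral {0..x} \<zeta>) = \<zeta>"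
proof -
  let ?\<phi> = "\<lambda>x. integral {0..x} \<zeta>"
  \<comment> \<open>This includes negative x, where {0..x} is empty and the integral is 0.\<close>
  have left: "?\<phi> x = 0" if "x < c" for x
    by (intro integral_unique has_integral_is_0) (use that cd in \<open>auto intro!: cd(3)\<close>)
  have right: "?\<phi> x = 0" if "x \<notin> {c..d}" "x \<ge> c" for x
  proof (cases "x \<le> 1")
    case True
    have io: "\<zeta> integrable_on {0..1}"
      by (intro integrable_continuous_real continuous_on_subset[OF \<zeta>]) auto
    have "?\<phi> x + integral {x..1} \<zeta> = integral {0..1} \<zeta>"
      using True that cd by (intro Henstock_Kurzweil_Integration.integral_combine io) auto
    moreover have "integral {x..1} \<zeta> = 0"
      by (intro integral_unique has_integral_is_0) (use that cd in \<open>auto intro!: cd(3)\<close>)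
    ultimately show ?thesis using int0 by simp
  next
    case False
    have io: "\<zeta> integrable_on {0..x}"
      by (intro integrable_continuous_real continuous_on_subset[OF \<zeta>]) auto
    have "integral {0..1} \<zeta> + integral {1..x} \<zeta> = ?\<phi> x"
      using False by (intro Henstock_Kurzweil_Integration.integral_combine io) auto
    moreover have "integral {1..x} \<zeta> = 0"
      by (intro integral_unique has_integral_is_0) (use that cd in \<open>auto intro!: cd(3)\<close>)
    ultimately show ?thesis using int0 by simp
  qed
  have D: "(?\<phi> has_real_derivative \<zeta> x) (at x)" for x
  proof (cases "x < c")
    case True
    then have "((\<lambda>_. 0) has_real_derivative \<zeta> x) (at x)" using cd by simp
    then show ?thesis
      by (rule has_field_derivative_transform_within_open[of _ _ _ "{..<c}"]) (use True left in auto)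
  next
    case False
    have "(?\<phi> has_real_derivative \<zeta> x) (at x within {0..x+1})"
      using False cd by (intro integral_has_real_derivative continuous_on_subset[OF \<zeta>]) auto
    then show ?thesis
      using False cd by (simp add: at_within_Icc_at)
  qed
  show "deriv ?\<phi> = \<zeta>" by (rule ext) (rule DERIV_imp_deriv[OF D])
  have "?\<phi> C1_differentiable_on UNIV"
    unfolding C1_differentiable_on_def
    using D \<zeta> by (intro exI[of _ \<zeta>]) (auto simp: has_real_derivative_iff_has_vector_derivative)
  moreover have "?\<phi> x = 0" if "x \<notin> {c..d}" for x
    using left right that by (cases "x < c") auto
  ultimately show "test_fun01 ?\<phi>" using cd unfolding test_fun01_def by blast
qed

section \<open>Passing between integrals over the open and the closed unit interval\<close>

lemma integrable_leb01_iff: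
  fixes f :: "real \<Rightarrow> real"
  shows "integrable leb01 f \<longleftrightarrow> f absolutely_integrable_on {0..1}"
  using absolutely_integrable_on_Icc_iff_Ioo[where f=f and a=0 and b=1]
  by (simp add: integrable_restrict_space set_integrable_def)

lemma lebesgue_integral_leb01:
  fixes f :: "real \<Rightarrow> real"
  assumes "integrable leb01 f"
  shows "(LINT x|leb01. f x) = integral {0..1} f"
  using lebesgue_integral_eq_integral[OF assms] by (simp add: integral_open_interval_real)

lemma continuous_integrable_leb01:
  fixes f :: "real \<Rightarrow> real"
  assumes "continuous_on {0..1} f"
  shows "integrable leb01 f"
  unfolding integrable_leb01_iff by (rule absolutely_integrable_continuous_real[OF assms])

lemma integrable_leb01_mult_continuous:
  fixes f h :: "real \<Rightarrow> real"
  assumes "integrable leb01 h" "continuous_on {0..1} f"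
  shows "integrable leb01 (\<lambda>x. h x * f x)"
proof -
  have "bounded (f ` {0..1})"
    using assms(2) by (intro compact_imp_bounded compact_continuous_image) auto
  moreover have "f \<in> borel_measurable (lebesgue_on {0..1})"
    using assms(2) by (intro continuous_imp_measurable_on_sets_lebesgue) auto
  ultimately have "(\<lambda>x. f x * h x) absolutely_integrable_on {0..1}"
    using assms(1) unfolding integrable_leb01_iff
    by (intro absolutely_integrable_bounded_measurable_product_real) auto
  then show ?thesis unfolding integrable_leb01_iff by (simp add: mult.commute)
qed

text \<open>Subtracting a multiple of one fixed bump \<open>\<eta>0\<close> turns any test function
  into one of zero mean, hence into the derivative of a test function. That \<open>h\<close>
  annihilates it says that \<open>h - c\<close> annihilates the original test function, and the zero
  case finishes.\<close>

lemma du_Bois_Reymond_const: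
  fixes h :: "real \<Rightarrow> real"
  assumes h: "integrable leb01 h"
    and test: "\<And>\<phi>. test_fun01 \<phi> \<Longrightarrow> (LINT x|leb01. h x * deriv \<phi> x) = 0"
  shows "\<exists>c. AE x in leb01. h x = c"
proof -
  define \<eta>0 :: "real \<Rightarrow> real" where
    "\<eta>0 = (\<lambda>x. 1 - 1 / (1 + 1 * (max 0 ((x - 1/3) * (2/3 - x)))\<^sup>2))"
  have t0: "test_fun01 \<eta>0" unfolding \<eta>0_def by (rule test_fun01_bump) auto
  note c0 = test_fun01_continuous_deriv(3)[OF t0]
  have nn0: "\<eta>0 x \<ge> 0" for x
  proof -
    have "1 \<le> 1 + 1 * (max 0 ((x - 1/3) * (2/3 - x)))\<^sup>2" by simp
    then have "1 / (1 + 1 * (max 0 ((x - 1/3) * (2/3 - x)))\<^sup>2) \<le> 1"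
      by (subst divide_le_eq_1_pos) linarith+
    then show ?thesis unfolding \<eta>0_def by linarith
  qed
  define I where "I = integral {0..1} \<eta>0"
  have "I \<noteq> 0"
  proof
    assume "I = 0"
    then have "\<forall>x\<in>{0..1}. \<eta>0 x = 0"
      using integral_eq_0_iff[of 0 1 \<eta>0] continuous_on_subset[OF c0] nn0 unfolding I_def by auto
    then have "\<eta>0 (1/2) = 0" by auto
    then show False by (simp add: \<eta>0_def power2_eq_square)
  qed
  \<comment> \<open>The only possible value: if h is almost everywhere constant, its integral
    against \<open>\<eta>0\<close> is that constant times \<open>I\<close>.\<close>
  define c where "c = (LINT x|leb01. h x * \<eta>0 x) / I"
  have "AE x in leb01. h x - c = 0"
  proof (rule du_Bois_Reymond_zero)
    show "set_integrable lebesgue {p..q} (\<lambda>x. h x - c)" if "0 < p" "q < 1" for p q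
    proof -
      have "(\<lambda>x. h x - c) absolutely_integrable_on {0..1}"
        using h continuous_integrable_leb01[of "\<lambda>_. c"] unfolding integrable_leb01_iff[symmetric] by simp
      then show ?thesis using that by (rule_tac absolutely_integrable_on_subinterval[where S="{0..1}"]) auto
    qed
    fix \<eta> assume t: "test_fun01 \<eta>"
    note c1 = test_fun01_continuous_deriv(3)[OF t]
    define J where "J = integral {0..1} \<eta>"
    \<comment> \<open>The coefficient J / I is chosen so that the integral of \<open>\<zeta>\<close>
      is 0.\<close>
    define \<zeta> where "\<zeta> = (\<lambda>x. \<eta> x - (J / I) * \<eta>0 x)"
    have cont: "continuous_on UNIV \<zeta>"
      unfolding \<zeta>_def by (intro continuous_intros c0 c1)
    obtain p q where pq: "0 < p" "q < 1" "\<And>x. x \<notin> {p..q} \<Longrightarrow> \<eta> x = 0"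
      using t by (auto simp: test_fun01_def)
    obtain p0 q0 where pq0: "0 < p0" "q0 < 1" "\<And>x. x \<notin> {p0..q0} \<Longrightarrow> \<eta>0 x = 0"
      using t0 by (auto simp: test_fun01_def)
    have i: "\<eta> integrable_on {0..1}" "\<eta>0 integrable_on {0..1}"
      by (intro integrable_continuous_real continuous_on_subset[OF c1] continuous_on_subset[OF c0]; auto)+
    have "((\<lambda>x. \<eta> x - (J / I) * \<eta>0 x) has_integral (J - (J / I) * I)) {0..1}"
      using i unfolding I_def J_def
      by (intro has_integral_diff has_integral_mult_right integrable_integral)
    then have int0: "integral {0..1} \<zeta> = 0"
      using \<open>I \<noteq> 0\<close> unfolding \<zeta>_def by (simp add: integral_unique)
    have z: "\<zeta> x = 0" if "x \<notin> {min p p0..max q q0}" for x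
    proof -
      have "x \<notin> {p..q}" "x \<notin> {p0..q0}" using that by auto
      then show ?thesis using pq(3) pq0(3) by (simp add: \<zeta>_def)
    qed
    have b: "0 < min p p0" "max q q0 < 1" using pq pq0 by auto
    note anti = test_fun01_antiderivative[OF cont b z int0]
    have "(LINT x|leb01. h x * \<zeta> x) = 0"
      using test[OF anti(1)] anti(2) by simp
    moreover have i1: "integrable leb01 (\<lambda>x. h x * \<eta> x)" "integrable leb01 (\<lambda>x. h x * \<eta>0 x)"
      "integrable leb01 \<eta>"
      by (intro integrable_leb01_mult_continuous h continuous_integrable_leb01
          continuous_on_subset[OF c1] continuous_on_subset[OF c0]; simp)+
    moreover have "(LINT x|leb01. h x * \<zeta> x) = (LINT x|leb01. h x * \<eta> x - (J / I) * (h x * \<eta>0 x))"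
      by (simp add: \<zeta>_def algebra_simps)
    ultimately have "(LINT x|leb01. h x * \<eta> x) = (J / I) * (LINT x|leb01. h x * \<eta>0 x)"
      by simp
    moreover have "(LINT x|leb01. \<eta> x) = J"
      unfolding J_def by (rule lebesgue_integral_leb01[OF i1(3)])
    moreover have "(LINT x|leb01. (h x - c) * \<eta> x) = (LINT x|leb01. h x * \<eta> x) - c * (LINT x|leb01. \<eta> x)"
      using i1 by (simp add: left_diff_distrib)
    ultimately show "(LINT x|leb01. (h x - c) * \<eta> x) = 0"
      by (simp add: c_def)
  qed
  then show ?thesis by (intro exI[of _ c]) (auto elim: eventually_mono)
qed

text \<open>The primitive of an integrable \<open>w\<close> need not be differentiable everywhere,
  so Fubini's theorem takes the place of the product rule: a double integral over the triangle y
  \<le> x is evaluated in both orders. Only the smooth factor \<open>\<phi>\<close> is subjected to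
  the fundamental theorem of calculus. A Borel representative \<open>v\<close> of \<open>w\<close>
  provides the joint measurability.\<close>

lemma integration_by_parts_test_fun01:
  fixes w :: "real \<Rightarrow> real"
  assumes w: "integrable leb01 w" and t: "test_fun01 \<phi>"
  shows "(LINT x|leb01. integral {0..x} w * deriv \<phi> x) = - (LINT x|leb01. w x * \<phi> x)"
proof -
  obtain c d where cd: "0 < c" "c < d" "d < 1" "\<And>x. x \<notin> {c..d} \<Longrightarrow> \<phi> x = 0"
      "\<And>x. x \<notin> {c..d} \<Longrightarrow> deriv \<phi> x = 0"
    using test_fun01_support[OF t] by metis
  define p where "p = deriv \<phi>"
  have p: "(\<phi> has_real_derivative p x) (at x)" "continuous_on UNIV p" for x
    using test_fun01_continuous_deriv[OF t] by (auto simp: p_def)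
  have pm[measurable]: "p \<in> borel_measurable borel"
    using p(2) by (rule borel_measurable_continuous_onI)
  have \<phi>m[measurable]: "\<phi> \<in> borel_measurable borel"
    using test_fun01_continuous_deriv(3)[OF t] by (rule borel_measurable_continuous_onI)
  have ip: "integrable lborel p"
  proof -
    have "set_integrable lborel {c..d} p"
      using p(2) by (intro borel_integrable_atLeastAtMost' continuous_on_subset[OF p(2)]) auto
    moreover have "indicator {c..d} x *\<^sub>R p x = p x" for x
      using cd(5)[of x] by (auto simp: p_def indicator_def)
    ultimately show ?thesis unfolding set_integrable_def by (simp only:)
  qed
  define w1 where "w1 = (\<lambda>x. indicator {0<..<1} x * w x)"
  have iw1: "integrable lebesgue w1"
    using w unfolding w1_def by (simp add: integrable_restrict_space)
  obtain v where v[measurable]: "v \<in> borel_measurable lborel" and wv: "AE x in lborel. w1 x = v x"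
    using completion_ex_borel_measurable_real[of w1 lborel] iw1 by auto
  have wv': "AE x in lebesgue. w1 x = v x" using wv by (simp add: AE_completion_iff)
  have vm: "v \<in> borel_measurable lebesgue" by (rule measurable_completion) simp
  have "integrable lebesgue v"
    using iw1 by (rule Bochner_Integration.integrable_cong_AE_imp) (use wv' vm in \<open>auto simp: eq_commute\<close>)
  then have iv: "integrable lborel v" by (simp add: integrable_completion)
  \<comment> \<open>The indicator of {..x} at y encodes the triangle y \<le> x. Integrating over y
    yields the primitive of w times \<open>p x\<close>; integrating over x yields -
    \<open>\<phi> y\<close> times \<open>v y\<close>.\<close>
  define F where "F = (\<lambda>x y. p x * (indicator {..x} y * v y))"
  have iF: "integrable (lborel \<Otimes>\<^sub>M lborel) (case_prod F)"
  proof (rule Bochner_Integration.integrable_bound)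
    show "integrable (lborel \<Otimes>\<^sub>M lborel) (\<lambda>(x, y). p x * v y)"
    proof (rule lborel_pair.Fubini_integrable)
      show "integrable lborel (\<lambda>x. LBINT y. norm (case (x, y) of (x, y) \<Rightarrow> p x * v y))"
        using ip by (simp add: abs_mult)
      show "AE x in lborel. integrable lborel (\<lambda>y. case (x, y) of (x, y) \<Rightarrow> p x * v y)"
        using iv by simp
    qed measurable
    have "(\<lambda>(x, y). p x * ((if y \<le> x then 1 else 0) * v y)) \<in> borel_measurable (lborel \<Otimes>\<^sub>M lborel)"
      by measurable
    moreover have "case_prod F = (\<lambda>(x, y). p x * ((if y \<le> x then 1 else 0) * v y))"
      by (auto simp: F_def fun_eq_iff)
    ultimately show "case_prod F \<in> borel_measurable (lborel \<Otimes>\<^sub>M lborel)" by simp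
    show "AE x in lborel \<Otimes>\<^sub>M lborel. norm (case_prod F x) \<le> norm (case x of (x, y) \<Rightarrow> p x * v y)"
      by (auto simp: F_def abs_mult indicator_def)
  qed
  have eq: "(LBINT y. LBINT x. F x y) = (LBINT x. LBINT y. F x y)"
    by (rule lborel_pair.Fubini_integral[OF iF])
  have innerx: "(LBINT x. F x y) = - (v y * \<phi> y)" for y
  proof -
    \<comment> \<open>A point to the right of y and of the support of \<open>\<phi>\<close>: the
      boundary term \<open>\<phi> Z\<close> vanishes and nothing of \<open>p\<close> is lost beyond
      it.\<close>
    define Z where "Z = max y 1 + 1"
    have "(LBINT x. p x * indicator {y..Z} x) = \<phi> Z - \<phi> y"
      using p by (intro integral_FTC_Icc_real) (auto simp: Z_def continuous_on_eq_continuous_at)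
    moreover have "\<phi> Z = 0" using cd by (intro cd(4)) (auto simp: Z_def)
    moreover have "(LBINT x. F x y) = (LBINT x. v y * (p x * indicator {y..Z} x))"
    proof (intro Bochner_Integration.integral_cong refl)
      fix x :: real
      have "p x = 0" if "x > Z" using that cd by (auto simp: Z_def p_def intro!: cd(5))
      then show "F x y = v y * (p x * indicator {y..Z} x)"
        by (auto simp: F_def indicator_def not_le)
    qed
    ultimately show ?thesis by simp
  qed
  have innery: "(LBINT y. F x y) = indicator {0<..<1} x * (integral {0..x} w * p x)" for x
  proof (cases "x \<in> {0<..<1}")
    case False
    then have "p x = 0" using cd by (auto simp: p_def intro!: cd(5))
    then show ?thesis by (simp add: F_def)
  next
    case True
    have "(LBINT y. indicator {..x} y * v y) = (LINT y|lebesgue. indicator {..x} y * v y)"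
      by (rule integral_completion[symmetric]) (intro borel_measurable_times borel_measurable_indicator v, simp)
    also have "\<dots> = (LINT y|lebesgue. indicator {0..x} y * w y)"
    proof (rule integral_cong_AE)
      have ai: "w absolutely_integrable_on {0..x}"
        using w True unfolding integrable_leb01_iff
        by (rule_tac absolutely_integrable_on_subinterval[where S="{0..1}"]) auto
      show "(\<lambda>y. indicator {0..x} y * w y) \<in> borel_measurable lebesgue"
        using ai by (auto simp: set_integrable_def)
      \<comment> \<open>\<open>w1\<close> is cut off to the open interval while {0..x} contains 0;
        the two integrands may differ at this one point.\<close>
      have "AE y in lebesgue. y \<notin> {0::real}"
        by (rule AE_not_in) (simp add: finite_imp_null_set_lborel null_sets_completionI)
      with wv' show "AE y in lebesgue. indicator {..x} y * v y = indicator {0..x} y * w y"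
        by eventually_elim (use True in \<open>auto simp: w1_def indicator_def split: if_splits\<close>)
      show "(\<lambda>y. indicator {..x} y * v y) \<in> borel_measurable lebesgue"
        by (rule measurable_completion) simp
    qed
    also have "\<dots> = integral {0..x} w"
    proof -
      have "w absolutely_integrable_on {0..x}"
        using w True unfolding integrable_leb01_iff
        by (rule_tac absolutely_integrable_on_subinterval[where S="{0..1}"]) auto
      from set_lebesgue_integral_eq_integral(2)[OF this] show ?thesis
        by (simp add: set_lebesgue_integral_def)
    qed
    finally show ?thesis using True by (simp add: F_def)
  qed
  have "(LINT x|leb01. integral {0..x} w * deriv \<phi> x) = (LINT x|lebesgue. indicator {0<..<1} x * (integral {0..x} w * p x))"
    by (subst integral_restrict_space) (auto simp: p_def)
  also have "\<dots> = (LBINT x. indicator {0<..<1} x * (integral {0..x} w * p x))"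
  proof (rule integral_completion)
    have "(\<lambda>x. LBINT y. F x y) \<in> borel_measurable lborel"
      using lborel_pair.integrable_fst'[OF iF] by auto
    then show "(\<lambda>x. indicator {0<..<1} x * (integral {0..x} w * p x)) \<in> borel_measurable lborel"
      by (simp add: innery)
  qed
  also have "\<dots> = (LBINT y. - (v y * \<phi> y))"
    using eq by (simp add: innery innerx)
  also have "\<dots> = (LINT y|lebesgue. - (v y * \<phi> y))"
    by (intro integral_completion[symmetric]) measurable
  also have "\<dots> = (LINT y|lebesgue. - (w1 y * \<phi> y))"
  proof (rule integral_cong_AE)
    have \<phi>l: "\<phi> \<in> borel_measurable lebesgue" by (rule measurable_completion) simp
    show "(\<lambda>y. - (v y * \<phi> y)) \<in> borel_measurable lebesgue"
      "(\<lambda>y. - (w1 y * \<phi> y)) \<in> borel_measurable lebesgue"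
      using vm \<phi>l iw1 by auto
  qed (use wv' in \<open>auto elim: eventually_mono\<close>)
  also have "\<dots> = - (LINT x|leb01. w x * \<phi> x)"
    by (subst integral_restrict_space) (auto simp: w1_def mult.assoc)
  finally show ?thesis .
qed

text \<open>By the integration by parts above, \<open>u\<close> minus the primitive of
  \<open>w\<close> annihilates all derivatives of test functions, so it is constant. Integrability
  of \<open>w\<close> up to the endpoints makes the right-hand side continuous on the closed
  interval.\<close>

lemma weak_derivative_FTC:
  fixes u w :: "real \<Rightarrow> real"
  assumes u: "integrable leb01 u" and w: "integrable leb01 w"
    and uw: "\<And>\<phi>. test_fun01 \<phi> \<Longrightarrow> (LINT x|leb01. u x * deriv \<phi> x) = - (LINT x|leb01. w x * \<phi> x)"
  shows "\<exists>c. AE x in leb01. u x = c + integral {0..x} w"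
proof -
  have w': "w integrable_on {0..1}"
    using w unfolding integrable_leb01_iff by (rule set_lebesgue_integral_eq_integral(1))
  have W: "continuous_on {0..1} (\<lambda>x. integral {0..x} w)"
    by (rule indefinite_integral_continuous_1[OF w'])
  note iW = continuous_integrable_leb01[OF W]
  have "\<exists>c. AE x in leb01. u x - integral {0..x} w = c"
  proof (rule du_Bois_Reymond_const)
    show "integrable leb01 (\<lambda>x. u x - integral {0..x} w)" using u iW by simp
    fix \<phi> assume t: "test_fun01 \<phi>"
    have cd: "continuous_on {0..1} (deriv \<phi>)"
      using test_fun01_continuous_deriv(2)[OF t] by (rule continuous_on_subset) simp
    have "(LINT x|leb01. (u x - integral {0..x} w) * deriv \<phi> x)
       = (LINT x|leb01. u x * deriv \<phi> x) - (LINT x|leb01. integral {0..x} w * deriv \<phi> x)"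
      using integrable_leb01_mult_continuous[OF u cd] integrable_leb01_mult_continuous[OF iW cd]
      by (simp add: left_diff_distrib)
    then show "(LINT x|leb01. (u x - integral {0..x} w) * deriv \<phi> x) = 0"
      using uw[OF t] integration_by_parts_test_fun01[OF w t] by simp
  qed
  then obtain c where "AE x in leb01. u x - integral {0..x} w = c" by blast
  then show ?thesis by (intro exI[of _ c]) (auto elim: eventually_mono)
qed

section \<open>Linearity of weak derivatives\<close>

lemma rep_aefun_measurable[measurable]: "rep_aefun u \<in> borel_measurable leb01"
  using Quotient3_rep_reflp[OF Quotient3_aefun, of u] by (simp add: ae_eq01_def)

lemma rep_abs_aefun:
  assumes "f \<in> borel_measurable leb01"
  shows "AE x in leb01. rep_aefun (abs_aefun f) x = f x"
proof -
  have "ae_eq01 f f" using assms by (simp add: ae_eq01_def)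
  from Quotient3_rep_abs[OF Quotient3_aefun, OF this] show ?thesis by (simp add: ae_eq01_def)
qed

lemma aefun_eqI:
  assumes "AE x in leb01. rep_aefun u x = rep_aefun v x"
  shows "u = v"
  using assms Quotient3_rel_rep[OF Quotient3_aefun, of u v] by (simp add: ae_eq01_def)

lemma rep_aefun_zero: "AE x in leb01. rep_aefun 0 x = 0"
  unfolding zero_aefun_def by (rule rep_abs_aefun) simp

lemma rep_aefun_add: "AE x in leb01. rep_aefun (u + v) x = rep_aefun u x + rep_aefun v x"
  unfolding plus_aefun_def map_fun_def comp_def by (rule rep_abs_aefun) simp

lemma rep_aefun_scaleR: "AE x in leb01. rep_aefun (c *\<^sub>R u) x = c * rep_aefun u x"
  unfolding scaleR_aefun_def map_fun_def comp_def id_def by (rule rep_abs_aefun) simp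

lemma AE_leb01_iff: "(AE x in leb01. P x) \<longleftrightarrow> (AE x in lebesgue. 0 < x \<and> x < 1 \<longrightarrow> P x)"
  by (subst AE_restrict_space_iff) auto

lemma set_integrable_cong_AE_leb01:
  fixes f g :: "real \<Rightarrow> real"
  assumes "AE x in leb01. f x = g x" "0 < c" "d < 1" "set_integrable lebesgue {c..d} f"
  shows "set_integrable lebesgue {c..d} g"
proof -
  obtain N where N: "N \<in> null_sets lebesgue" "\<And>x. x \<notin> N \<Longrightarrow> 0 < x \<Longrightarrow> x < 1 \<Longrightarrow> f x = g x"
    using assms(1) unfolding AE_leb01_iff completion.AE_iff_null_sets by auto
  show ?thesis
    by (rule absolutely_integrable_spike[OF assms(4), of N])
      (use N assms in \<open>auto simp: negligible_iff_null_sets\<close>)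
qed

lemma loc_integrable01_add:
  assumes "loc_integrable01 u" "loc_integrable01 v"
  shows "loc_integrable01 (u + v)"
  unfolding loc_integrable01_def
proof safe
  fix c d :: real assume cd: "0 < c" "d < 1"
  then have "set_integrable lebesgue {c..d} (\<lambda>x. rep_aefun u x + rep_aefun v x)"
    using assms by (intro set_integral_add) (auto simp: loc_integrable01_def)
  moreover have "AE x in leb01. rep_aefun u x + rep_aefun v x = rep_aefun (u + v) x"
    using rep_aefun_add[of u v] by eventually_elim simp
  ultimately show "set_integrable lebesgue {c..d} (rep_aefun (u + v))"
    using cd by (rule_tac set_integrable_cong_AE_leb01)
qed

lemma loc_integrable01_scaleR:
  assumes "loc_integrable01 u"
  shows "loc_integrable01 (r *\<^sub>R u)"
  unfolding loc_integrable01_def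
proof safe
  fix c d :: real assume cd: "0 < c" "d < 1"
  then have "set_integrable lebesgue {c..d} (\<lambda>x. r * rep_aefun u x)"
    using assms by (auto simp: loc_integrable01_def)
  moreover have "AE x in leb01. r * rep_aefun u x = rep_aefun (r *\<^sub>R u) x"
    using rep_aefun_scaleR[of r u] by eventually_elim simp
  ultimately show "set_integrable lebesgue {c..d} (rep_aefun (r *\<^sub>R u))"
    using cd by (rule_tac set_integrable_cong_AE_leb01)
qed

text \<open>Makes the two sides of the weak derivative identity additive: the integral of a
  non-integrable function is 0 by default, so additivity has to be backed by integrability of each
  pairing.\<close>

lemma loc_integrable01_mult_compact_support:
  assumes "loc_integrable01 u" "continuous_on UNIV \<psi>" "0 < c" "d < 1" "\<And>x. x \<notin> {c..d} \<Longrightarrow> \<psi> x = 0"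
  shows "integrable leb01 (\<lambda>x. rep_aefun u x * \<psi> x)"
proof -
  have u: "rep_aefun u absolutely_integrable_on {c..d}"
    using assms by (auto simp: loc_integrable01_def)
  have "bounded (\<psi> ` {c..d})"
    using assms(2) by (intro compact_imp_bounded compact_continuous_image continuous_on_subset[OF assms(2)]) auto
  moreover have "\<psi> \<in> borel_measurable (lebesgue_on {c..d})"
    by (intro continuous_imp_measurable_on_sets_lebesgue continuous_on_subset[OF assms(2)]) auto
  ultimately have "set_integrable lebesgue {c..d} (\<lambda>x. \<psi> x * rep_aefun u x)"
    using u by (intro absolutely_integrable_bounded_measurable_product_real) auto
  moreover have "indicator {c..d} x *\<^sub>R (\<psi> x * rep_aefun u x) = indicator {0<..<1} x *\<^sub>R (rep_aefun u x * \<psi> x)" for x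
    using assms(3-5) by (cases "x \<in> {c..d}") auto
  ultimately show ?thesis
    unfolding set_integrable_def by (subst integrable_restrict_space) (simp_all only:, auto)
qed

lemma loc_integrable01_mult_test:
  assumes "loc_integrable01 u" "test_fun01 \<phi>"
  shows "integrable leb01 (\<lambda>x. rep_aefun u x * \<phi> x)" "integrable leb01 (\<lambda>x. rep_aefun u x * deriv \<phi> x)"
proof -
  obtain c d where "0 < c" "c < d" "d < 1" "\<And>x. x \<notin> {c..d} \<Longrightarrow> \<phi> x = 0" "\<And>x. x \<notin> {c..d} \<Longrightarrow> deriv \<phi> x = 0"
    using test_fun01_support[OF assms(2)] by metis
  then show "integrable leb01 (\<lambda>x. rep_aefun u x * \<phi> x)" "integrable leb01 (\<lambda>x. rep_aefun u x * deriv \<phi> x)"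
    using test_fun01_continuous_deriv[OF assms(2)]
    by (auto intro!: loc_integrable01_mult_compact_support[OF assms(1), of _ c d])
qed

lemma integral_rep_aefun_add:
  assumes "integrable leb01 (\<lambda>x. rep_aefun u x * q x)" "integrable leb01 (\<lambda>x. rep_aefun v x * q x)"
    and [measurable]: "q \<in> borel_measurable leb01"
  shows "(LINT x|leb01. rep_aefun (u + v) x * q x)
    = (LINT x|leb01. rep_aefun u x * q x) + (LINT x|leb01. rep_aefun v x * q x)"
proof -
  have "(LINT x|leb01. rep_aefun (u + v) x * q x) = (LINT x|leb01. rep_aefun u x * q x + rep_aefun v x * q x)"
    by (rule integral_cong_AE; (measurable)?)
      (use rep_aefun_add[of u v] in \<open>eventually_elim, simp add: distrib_right\<close>)
  then show ?thesis using assms by simp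
qed

lemma integral_rep_aefun_scaleR:
  assumes [measurable]: "q \<in> borel_measurable leb01"
  shows "(LINT x|leb01. rep_aefun (c *\<^sub>R u) x * q x) = c * (LINT x|leb01. rep_aefun u x * q x)"
proof -
  have "(LINT x|leb01. rep_aefun (c *\<^sub>R u) x * q x) = (LINT x|leb01. c * (rep_aefun u x * q x))"
    by (rule integral_cong_AE; (measurable)?)
      (use rep_aefun_scaleR[of c u] in \<open>eventually_elim, simp\<close>)
  then show ?thesis by simp
qed

lemma continuous_on_measurable_leb01:
  fixes f :: "real \<Rightarrow> real"
  assumes "continuous_on {0<..<1} f"
  shows "f \<in> borel_measurable leb01"
  using assms by (intro continuous_imp_measurable_on_sets_lebesgue) auto

lemma test_fun01_measurable:
  assumes "test_fun01 \<phi>"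
  shows "\<phi> \<in> borel_measurable leb01" "deriv \<phi> \<in> borel_measurable leb01"
  by (intro continuous_on_measurable_leb01 continuous_on_subset[OF test_fun01_continuous_deriv(3)[OF assms]]
      continuous_on_subset[OF test_fun01_continuous_deriv(2)[OF assms]]; simp)+

lemma has_weak_deriv_add:
  assumes "has_weak_deriv u w" "has_weak_deriv u' w'"
  shows "has_weak_deriv (u + u') (w + w')"
  using assms unfolding has_weak_deriv_def
  by (simp add: loc_integrable01_add integral_rep_aefun_add test_fun01_measurable loc_integrable01_mult_test)

lemma has_weak_deriv_scaleR:
  assumes "has_weak_deriv u w"
  shows "has_weak_deriv (c *\<^sub>R u) (c *\<^sub>R w)"
  using assms unfolding has_weak_deriv_def
  by (simp add: loc_integrable01_scaleR integral_rep_aefun_scaleR test_fun01_measurable)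

lemma has_weak_deriv_zero_unique:
  assumes "has_weak_deriv 0 w"
  shows "w = 0"
proof -
  have w: "loc_integrable01 w" using assms by (simp add: has_weak_deriv_def)
  have "AE x in leb01. rep_aefun w x = 0"
  proof (rule du_Bois_Reymond_zero)
    show "set_integrable lebesgue {c..d} (rep_aefun w)" if "0 < c" "d < 1" for c d
      using w that by (simp add: loc_integrable01_def)
    fix \<phi> assume t: "test_fun01 \<phi>"
    note [measurable] = test_fun01_measurable[OF t]
    have "(LINT x|leb01. rep_aefun 0 x * deriv \<phi> x) = (LINT x|leb01. 0)"
      by (rule integral_cong_AE; (measurable)?)
        (use rep_aefun_zero in \<open>eventually_elim, simp\<close>)
    then show "(LINT x|leb01. rep_aefun w x * \<phi> x) = 0"
      using assms t by (auto simp: has_weak_deriv_def)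
  qed
  then show ?thesis
    using rep_aefun_zero by (intro aefun_eqI) (auto elim: eventually_elim2)
qed

lemma has_weak_deriv_unique:
  assumes "has_weak_deriv u w" "has_weak_deriv u w'"
  shows "w = w'"
proof -
  have "has_weak_deriv (u + (-1) *\<^sub>R u) (w + (-1) *\<^sub>R w')"
    by (intro has_weak_deriv_add has_weak_deriv_scaleR assms)
  then have "has_weak_deriv 0 (w - w')" by simp
  from has_weak_deriv_zero_unique[OF this] show ?thesis by simp
qed

text \<open>Turns the description \<open>wderiv\<close> into a value, so that linearity of the
  relation \<open>has_weak_deriv\<close> passes to the operator.\<close>

lemma wderiv_eqI: "has_weak_deriv u w \<Longrightarrow> wderiv u = w"
  unfolding wderiv_def by (rule the_equality) (auto intro: has_weak_deriv_unique)

lemma subspace_L2: "subspace L2"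
proof (rule subspaceI)
  have "integrable leb01 (\<lambda>x. (rep_aefun 0 x)\<^sup>2)"
    by (rule Bochner_Integration.integrable_cong_AE_imp[of _ "\<lambda>_. 0"])
      (use rep_aefun_zero in \<open>auto elim: eventually_mono\<close>)
  then show "0 \<in> L2" by (simp add: L2_def)
next
  fix u v assume "u \<in> L2" "v \<in> L2"
  then have i: "integrable leb01 (\<lambda>x. 2 * (rep_aefun u x)\<^sup>2 + 2 * (rep_aefun v x)\<^sup>2)"
    by (auto simp: L2_def)
  have "integrable leb01 (\<lambda>x. (rep_aefun (u + v) x)\<^sup>2)"
    using i
  proof (rule Bochner_Integration.integrable_bound)
    show "AE x in leb01. norm ((rep_aefun (u + v) x)\<^sup>2) \<le> norm (2 * (rep_aefun u x)\<^sup>2 + 2 * (rep_aefun v x)\<^sup>2)"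
      using rep_aefun_add[of u v]
    proof eventually_elim
      case (elim x)
      have "(a + b)\<^sup>2 \<le> 2 * a\<^sup>2 + 2 * b\<^sup>2" for a b :: real
        using sum_squares_bound[of a b] by (simp add: power2_sum)
      then show ?case using elim by simp
    qed
  qed simp
  then show "u + v \<in> L2" by (simp add: L2_def)
next
  fix c u assume "u \<in> L2"
  then have "integrable leb01 (\<lambda>x. c\<^sup>2 * (rep_aefun u x)\<^sup>2)" by (auto simp: L2_def)
  then have "integrable leb01 (\<lambda>x. (rep_aefun (c *\<^sub>R u) x)\<^sup>2)"
    by (rule Bochner_Integration.integrable_cong_AE_imp)
      (use rep_aefun_scaleR[of c u] in \<open>auto elim!: eventually_mono simp: power_mult_distrib\<close>)
  then show "c *\<^sub>R u \<in> L2" by (simp add: L2_def)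
qed

lemma finite_measure_leb01: "finite_measure leb01"
  by (rule finite_measureI) (simp add: emeasure_restrict_space)

text \<open>On a space of finite measure |z| \<le> 1 + z^2 suffices. Unlike local integrability,
  this reaches the endpoints, as continuity of primitives up to the boundary demands.\<close>

lemma L2_integrable:
  assumes "u \<in> L2"
  shows "integrable leb01 (rep_aefun u)"
proof (rule Bochner_Integration.integrable_bound)
  interpret finite_measure leb01 by (rule finite_measure_leb01)
  show "integrable leb01 (\<lambda>x. 1 + (rep_aefun u x)\<^sup>2)" using assms by (auto simp: L2_def)
  have "\<bar>z\<bar> \<le> 1 + z\<^sup>2" for z :: real
    using sum_squares_bound[of 1 "\<bar>z\<bar>"] zero_le_power2[of z] by simp
  then show "AE x in leb01. norm (rep_aefun u x) \<le> norm (1 + (rep_aefun u x)\<^sup>2)" by simp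
qed simp

lemma L2_loc_integrable01: "u \<in> L2 \<Longrightarrow> loc_integrable01 u"
  using L2_integrable[of u] unfolding loc_integrable01_def integrable_leb01_iff
  by (meson absolutely_integrable_on_subinterval atLeastatMost_subset_iff less_imp_le)

section \<open>Boundary values\<close>

text \<open>\<open>bdry_val\<close> asks for continuity up to one endpoint only; a representative
  continuous on the closed interval serves both endpoints at once.\<close>

definition cont_rep :: "aefun \<Rightarrow> (real \<Rightarrow> real) \<Rightarrow> bool" where
  "cont_rep u w \<longleftrightarrow> continuous_on {0..1} w \<and> (AE x in leb01. w x = rep_aefun u x)"

lemma continuous_AE_zero:
  fixes f :: "real \<Rightarrow> real"
  assumes "continuous_on {0<..<1} f" "AE x in leb01. f x = 0" "x \<in> {0<..<1}"
  shows "f x = 0"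
proof (rule ccontr)
  assume "f x \<noteq> 0"
  define U where "U = {0<..<1} \<inter> f -` (- {0})"
  have U: "open U" unfolding U_def using assms(1)
    by (rule continuous_open_preimage) auto
  have "x \<in> U" using \<open>f x \<noteq> 0\<close> assms(3) by (simp add: U_def)
  obtain N where N: "N \<in> null_sets lebesgue" "\<And>x. x \<notin> N \<Longrightarrow> 0 < x \<Longrightarrow> x < 1 \<Longrightarrow> f x = 0"
    using assms(2) unfolding AE_leb01_iff completion.AE_iff_null_sets by auto
  have "negligible U"
    by (rule negligible_subset[of N]) (use N in \<open>auto simp: negligible_iff_null_sets U_def\<close>)
  then show False using open_not_negligible[OF U] \<open>x \<in> U\<close> by auto
qed

text \<open>Two representatives continuous on the open interval agree there, since a nonzero
  difference would persist on an open set of positive measure. As p is a limit point of the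
  interval, their values at p agree too, so the description in \<open>bdry_val\<close> is
  unique.\<close>

lemma bdry_val_cont_rep:
  assumes "cont_rep u w" "p \<in> {0, 1}"
  shows "bdry_val u p = w p"
  unfolding bdry_val_def
proof (rule the_equality)
  show "\<exists>w'. continuous_on (insert p {0<..<1}) w' \<and> (AE x in leb01. w' x = rep_aefun u x) \<and> w' p = w p"
    using assms by (intro exI[of _ w]) (auto simp: cont_rep_def intro: continuous_on_subset)
  fix c assume "\<exists>w'. continuous_on (insert p {0<..<1}) w' \<and> (AE x in leb01. w' x = rep_aefun u x) \<and> w' p = c"
  then obtain v where v: "continuous_on (insert p {0<..<1}) v" "AE x in leb01. v x = rep_aefun u x" "v p = c"
    by blast
  have c: "continuous_on (insert p {0<..<1}) (\<lambda>x. v x - w x)"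
    using assms v(1) by (intro continuous_intros) (auto simp: cont_rep_def intro: continuous_on_subset)
  have 0: "v x - w x = 0" if "x \<in> {0<..<1}" for x
  proof (rule continuous_AE_zero[of "\<lambda>x. v x - w x", OF _ _ that])
    show "AE x in leb01. v x - w x = 0"
      using v(2) assms(1) by (auto simp: cont_rep_def elim: eventually_elim2)
  qed (use c in \<open>auto intro: continuous_on_subset\<close>)
  have "((\<lambda>x. v x - w x) \<longlongrightarrow> v p - w p) (at p within {0<..<1})"
    using c by (auto simp: continuous_on_def intro: tendsto_within_subset)
  moreover have "((\<lambda>x. v x - w x) \<longlongrightarrow> 0) (at p within {0<..<1})"
    by (rule tendsto_eventually) (use 0 in \<open>auto simp: eventually_at_filter intro!: always_eventually\<close>)
  moreover have "at p within {0<..<1} \<noteq> bot"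
    using assms(2) by (auto simp: trivial_limit_within islimpt_greaterThanLessThan1 islimpt_greaterThanLessThan2)
  ultimately have "v p - w p = 0" using tendsto_unique by blast
  then show "c = w p" using v by simp
qed

lemma cont_rep_exists:
  assumes "u \<in> L2" "w \<in> L2" "has_weak_deriv u w"
  shows "\<exists>v. cont_rep u v"
proof -
  obtain c where c: "AE x in leb01. rep_aefun u x = c + integral {0..x} (rep_aefun w)"
    using weak_derivative_FTC[OF L2_integrable[OF assms(1)] L2_integrable[OF assms(2)]] assms(3)
    by (auto simp: has_weak_deriv_def)
  have "rep_aefun w integrable_on {0..1}"
    using L2_integrable[OF assms(2)] unfolding integrable_leb01_iff
    by (rule set_lebesgue_integral_eq_integral(1))
  then have "continuous_on {0..1} (\<lambda>x. c + integral {0..x} (rep_aefun w))"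
    by (intro continuous_intros indefinite_integral_continuous_1)
  then show ?thesis
    using c unfolding cont_rep_def
    by (intro exI[of _ "\<lambda>x. c + integral {0..x} (rep_aefun w)"]) (auto elim: eventually_mono)
qed

lemma cont_rep_add:
  assumes "cont_rep u w" "cont_rep u' w'"
  shows "cont_rep (u + u') (\<lambda>x. w x + w' x)"
proof -
  have "AE x in leb01. w x = rep_aefun u x" "AE x in leb01. w' x = rep_aefun u' x"
    using assms by (auto simp: cont_rep_def)
  then have "AE x in leb01. w x + w' x = rep_aefun (u + u') x"
    using rep_aefun_add[of u u'] by eventually_elim simp
  then show ?thesis using assms by (auto simp: cont_rep_def intro!: continuous_intros)
qed

lemma cont_rep_scaleR:
  assumes "cont_rep u w"
  shows "cont_rep (c *\<^sub>R u) (\<lambda>x. c * w x)"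
proof -
  have "AE x in leb01. w x = rep_aefun u x" using assms by (auto simp: cont_rep_def)
  then have "AE x in leb01. c * w x = rep_aefun (c *\<^sub>R u) x"
    using rep_aefun_scaleR[of c u] by eventually_elim simp
  then show ?thesis using assms by (auto simp: cont_rep_def intro!: continuous_intros)
qed

lemma cont_rep_zero: "cont_rep 0 (\<lambda>_. 0)"
  using rep_aefun_zero by (auto simp: cont_rep_def elim: eventually_mono)

lemma bdry_val_add:
  assumes "cont_rep u w" "cont_rep v w'" "p \<in> {0, 1}"
  shows "bdry_val (u + v) p = bdry_val u p + bdry_val v p"
  using bdry_val_cont_rep[OF assms(1,3)] bdry_val_cont_rep[OF assms(2,3)]
    bdry_val_cont_rep[OF cont_rep_add[OF assms(1,2)] assms(3)] by simp

lemma bdry_val_scaleR: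
  assumes "cont_rep u w" "p \<in> {0, 1}"
  shows "bdry_val (c *\<^sub>R u) p = c * bdry_val u p"
  using bdry_val_cont_rep[OF assms] bdry_val_cont_rep[OF cont_rep_scaleR[OF assms(1)] assms(2)] by simp

lemma bdry_val_zero: "p \<in> {0, 1} \<Longrightarrow> bdry_val 0 p = 0"
  using bdry_val_cont_rep[OF cont_rep_zero] .

lemma has_weak_deriv_zero: "has_weak_deriv 0 0"
proof -
  have "loc_integrable01 0" using L2_loc_integrable01 subspace_0[OF subspace_L2] by blast
  moreover have "(LINT x|leb01. rep_aefun 0 x * q x) = 0" if [measurable]: "q \<in> borel_measurable leb01" for q
    using integral_rep_aefun_scaleR[OF that, of 0 0] by simp
  ultimately show ?thesis unfolding has_weak_deriv_def by (simp add: test_fun01_measurable)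
qed

lemma wderiv_zero: "wderiv 0 = 0"
  by (rule wderiv_eqI[OF has_weak_deriv_zero])

section \<open>Linear structure of the second order Sobolev space\<close>

lemma H2_D:
  assumes "u \<in> H2"
  shows "u \<in> L2" "wderiv u \<in> L2" "(wderiv ^^ 2) u \<in> L2" "has_weak_deriv u (wderiv u)"
    "has_weak_deriv (wderiv u) ((wderiv ^^ 2) u)"
proof -
  obtain u1 u2 where "u \<in> L2" "u1 \<in> L2" "u2 \<in> L2" and d: "has_weak_deriv u u1" "has_weak_deriv u1 u2"
    using assms by (auto simp: H2_def)
  moreover have "wderiv u = u1" "(wderiv ^^ 2) u = u2"
    using d by (auto simp: wderiv_eqI numeral_2_eq_2)
  ultimately show "u \<in> L2" "wderiv u \<in> L2" "(wderiv ^^ 2) u \<in> L2" "has_weak_deriv u (wderiv u)"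
    "has_weak_deriv (wderiv u) ((wderiv ^^ 2) u)" by auto
qed

lemma subspace_H2: "subspace H2"
proof (rule subspaceI)
  show "0 \<in> H2"
    using has_weak_deriv_zero subspace_0[OF subspace_L2] by (auto simp: H2_def)
  show "u + v \<in> H2" if "u \<in> H2" "v \<in> H2" for u v
    using H2_D[OF that(1)] H2_D[OF that(2)] subspace_add[OF subspace_L2] has_weak_deriv_add
    unfolding H2_def by blast
  show "c *\<^sub>R u \<in> H2" if "u \<in> H2" for c u
    using H2_D[OF that] subspace_scale[OF subspace_L2] has_weak_deriv_scaleR
    unfolding H2_def by blast
qed

lemma H2_wderiv_add:
  assumes "u \<in> H2" "v \<in> H2"
  shows "wderiv (u + v) = wderiv u + wderiv v" "(wderiv ^^ 2) (u + v) = (wderiv ^^ 2) u + (wderiv ^^ 2) v"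
proof -
  show 1: "wderiv (u + v) = wderiv u + wderiv v"
    using H2_D(4) assms by (intro wderiv_eqI has_weak_deriv_add)
  have "wderiv (wderiv u + wderiv v) = (wderiv ^^ 2) u + (wderiv ^^ 2) v"
    using H2_D(5) assms by (intro wderiv_eqI has_weak_deriv_add)
  then show "(wderiv ^^ 2) (u + v) = (wderiv ^^ 2) u + (wderiv ^^ 2) v"
    using 1 by (simp add: numeral_2_eq_2)
qed

lemma H2_wderiv_scaleR:
  assumes "u \<in> H2"
  shows "wderiv (c *\<^sub>R u) = c *\<^sub>R wderiv u" "(wderiv ^^ 2) (c *\<^sub>R u) = c *\<^sub>R (wderiv ^^ 2) u"
proof -
  show 1: "wderiv (c *\<^sub>R u) = c *\<^sub>R wderiv u"
    using H2_D(4) assms by (intro wderiv_eqI has_weak_deriv_scaleR)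
  have "wderiv (c *\<^sub>R wderiv u) = c *\<^sub>R (wderiv ^^ 2) u"
    using H2_D(5) assms by (intro wderiv_eqI has_weak_deriv_scaleR)
  then show "(wderiv ^^ 2) (c *\<^sub>R u) = c *\<^sub>R (wderiv ^^ 2) u"
    using 1 by (simp add: numeral_2_eq_2)
qed

lemma H2_cont_rep:
  assumes "u \<in> H2"
  obtains w w1 where "cont_rep u w" "cont_rep (wderiv u) w1"
  using cont_rep_exists[OF H2_D(1,2,4)[OF assms]] cont_rep_exists[OF H2_D(2,3,5)[OF assms]] by blast

lemma H2_bdry_val_add:
  assumes "u \<in> H2" "v \<in> H2" "p \<in> {0, 1}"
  shows "bdry_val (u + v) p = bdry_val u p + bdry_val v p"
    "bdry_val (wderiv (u + v)) p = bdry_val (wderiv u) p + bdry_val (wderiv v) p"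
proof -
  obtain w w1 where w: "cont_rep u w" "cont_rep (wderiv u) w1" by (rule H2_cont_rep[OF assms(1)])
  obtain v' v1 where v: "cont_rep v v'" "cont_rep (wderiv v) v1" by (rule H2_cont_rep[OF assms(2)])
  show "bdry_val (u + v) p = bdry_val u p + bdry_val v p"
    by (rule bdry_val_add[OF w(1) v(1) assms(3)])
  show "bdry_val (wderiv (u + v)) p = bdry_val (wderiv u) p + bdry_val (wderiv v) p"
    unfolding H2_wderiv_add[OF assms(1,2)] by (rule bdry_val_add[OF w(2) v(2) assms(3)])
qed

lemma H2_bdry_val_scaleR:
  assumes "u \<in> H2" "p \<in> {0, 1}"
  shows "bdry_val (c *\<^sub>R u) p = c * bdry_val u p"
    "bdry_val (wderiv (c *\<^sub>R u)) p = c * bdry_val (wderiv u) p"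
proof -
  obtain w w1 where w: "cont_rep u w" "cont_rep (wderiv u) w1" by (rule H2_cont_rep[OF assms(1)])
  show "bdry_val (c *\<^sub>R u) p = c * bdry_val u p"
    by (rule bdry_val_scaleR[OF w(1) assms(2)])
  show "bdry_val (wderiv (c *\<^sub>R u)) p = c * bdry_val (wderiv u) p"
    unfolding H2_wderiv_scaleR[OF assms(1)] by (rule bdry_val_scaleR[OF w(2) assms(2)])
qed

section \<open>Norms from semi-inner products\<close>

text \<open>A common interface for the energy norm, the weighted norm and the unweighted norm, all
  of which are functions on a subspace and not norms of a type.\<close>

locale seminorm_on =
  fixes V :: "'v::real_vector set" and N :: "'v \<Rightarrow> real"
  assumes subspace: "subspace V"
    and nonneg: "x \<in> V \<Longrightarrow> 0 \<le> N x"
    and triangle: "x \<in> V \<Longrightarrow> y \<in> V \<Longrightarrow> N (x + y) \<le> N x + N y"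
    and scale: "x \<in> V \<Longrightarrow> N (c *\<^sub>R x) = \<bar>c\<bar> * N x"
begin

lemma zero: "N 0 = 0"
  using scale[of 0 0] subspace_0[OF subspace] by simp

lemma minus_commute: "x \<in> V \<Longrightarrow> y \<in> V \<Longrightarrow> N (x - y) = N (y - x)"
  using scale[of "x - y" "-1"] subspace_diff[OF subspace] by simp

lemma triangle_diff: "x \<in> V \<Longrightarrow> y \<in> V \<Longrightarrow> N x \<le> N (x - y) + N y"
  using triangle[of "x - y" y] subspace_diff[OF subspace] by simp

lemma triangle_minus: "x \<in> V \<Longrightarrow> y \<in> V \<Longrightarrow> N (x - y) \<le> N x + N y"
  using triangle[of x "- y"] scale[of y "-1"] subspace_neg[OF subspace] by simp

lemma abs_diff_le: "x \<in> V \<Longrightarrow> y \<in> V \<Longrightarrow> \<bar>N x - N y\<bar> \<le> N (x - y)"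
  using triangle_diff[of x y] triangle_diff[of y x] minus_commute[of x y] by auto

lemma sum_le:
  assumes "\<And>i. i \<in> I \<Longrightarrow> f i \<in> V"
  shows "N (sum f I) \<le> (\<Sum>i\<in>I. N (f i))"
  using assms
proof (induction I rule: infinite_finite_induct)
  case (insert i I)
  then have "N (f i + sum f I) \<le> N (f i) + N (sum f I)"
    by (intro triangle subspace_sum[OF subspace]) auto
  then show ?case using insert by auto
qed (auto simp: zero)

end

locale semi_inner_on =
  fixes V :: "'v::real_vector set" and B :: "'v \<Rightarrow> 'v \<Rightarrow> real"
  assumes subspace: "subspace V"
    and sym: "x \<in> V \<Longrightarrow> y \<in> V \<Longrightarrow> B x y = B y x"
    and add_left: "x \<in> V \<Longrightarrow> y \<in> V \<Longrightarrow> z \<in> V \<Longrightarrow> B (x + y) z = B x z + B y z"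
    and scale_left: "x \<in> V \<Longrightarrow> y \<in> V \<Longrightarrow> B (c *\<^sub>R x) y = c * B x y"
    and nonneg: "x \<in> V \<Longrightarrow> 0 \<le> B x x"
begin

lemma square_add:
  assumes "x \<in> V" "y \<in> V"
  shows "B (x + t *\<^sub>R y) (x + t *\<^sub>R y) = B x x + 2 * t * B x y + t\<^sup>2 * B y y"
proof -
  have V: "t *\<^sub>R y \<in> V" "x + t *\<^sub>R y \<in> V"
    using assms subspace_scale[OF subspace] subspace_add[OF subspace] by auto
  have 1: "B x (x + t *\<^sub>R y) = B x x + t * B x y"
    using sym[of x "x + t *\<^sub>R y"] add_left[of x "t *\<^sub>R y" x] scale_left[of y x t] sym[of x y] assms V by simp
  have 2: "B y (x + t *\<^sub>R y) = B x y + t * B y y"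
    using sym[of y "x + t *\<^sub>R y"] add_left[of x "t *\<^sub>R y" y] scale_left[of y y t] assms V by simp
  have "B (x + t *\<^sub>R y) (x + t *\<^sub>R y) = B x (x + t *\<^sub>R y) + t * B y (x + t *\<^sub>R y)"
    using add_left[of x "t *\<^sub>R y" "x + t *\<^sub>R y"] scale_left[of y "x + t *\<^sub>R y" t] assms V by simp
  then show ?thesis unfolding 1 2 by (simp add: power2_eq_square algebra_simps)
qed

lemma Cauchy_Schwarz:
  assumes "x \<in> V" "y \<in> V"
  shows "\<bar>B x y\<bar> \<le> sqrt (B x x) * sqrt (B y y)"
proof -
  have pos: "0 \<le> B x x + 2 * t * B x y + t\<^sup>2 * B y y" for t
    using square_add[OF assms, of t] nonneg[of "x + t *\<^sub>R y"] assms
      subspace_scale[OF subspace] subspace_add[OF subspace] by auto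
  have "(B x y)\<^sup>2 \<le> B x x * B y y"
  proof (cases "B y y = 0")
    case True
    have "B x y = 0"
    proof (rule ccontr)
      assume ne: "B x y \<noteq> 0"
      \<comment> \<open>With B y y = 0 the quadratic is affine in t; at this t it equals -1,
        contradicting positivity.\<close>
      have "2 * (- (B x x + 1) / (2 * B x y)) * B x y = - (B x x + 1)" using ne by (simp add: field_simps)
      with pos[of "- (B x x + 1) / (2 * B x y)"] True show False by simp
    qed
    then show ?thesis using True by simp
  next
    case False
    then have p: "B y y > 0" using nonneg[OF assms(2)] by simp
    \<comment> \<open>The value of the quadratic at its minimiser t = - B x y / B y y.\<close>
    have "0 \<le> B x x - (B x y)\<^sup>2 / B y y"
      using pos[of "- B x y / B y y"] p by (simp add: power2_eq_square field_simps)
    then show ?thesis using p by (simp add: field_simps)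
  qed
  then have "sqrt ((B x y)\<^sup>2) \<le> sqrt (B x x * B y y)" by (rule real_sqrt_le_mono)
  then show ?thesis by (simp add: real_sqrt_mult)
qed

sublocale seminorm_on V "\<lambda>x. sqrt (B x x)"
proof
  fix x y assume xy: "x \<in> V" "y \<in> V"
  have "B (x + y) (x + y) = B x x + 2 * B x y + B y y"
    using square_add[OF xy, of 1] by simp
  also have "\<dots> \<le> (sqrt (B x x) + sqrt (B y y))\<^sup>2"
    using Cauchy_Schwarz[OF xy] nonneg xy by (simp add: power2_sum)
  finally show "sqrt (B (x + y) (x + y)) \<le> sqrt (B x x) + sqrt (B y y)"
    using nonneg xy by (simp add: real_le_lsqrt)
next
  fix x c assume x: "x \<in> V"
  have "B (c *\<^sub>R x) (c *\<^sub>R x) = c\<^sup>2 * B x x"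
    using x scale_left[of x "c *\<^sub>R x" c] scale_left[of x x c] sym[of x "c *\<^sub>R x"] subspace_scale[OF subspace x]
    by (simp add: power2_eq_square)
  then show "sqrt (B (c *\<^sub>R x) (c *\<^sub>R x)) = \<bar>c\<bar> * sqrt (B x x)" by (simp add: real_sqrt_mult)
qed (simp_all add: subspace nonneg)

end

section \<open>Weighted square integrable functions and the energy space\<close>

locale weight =
  fixes a :: "real \<Rightarrow> real"
  assumes weight_measurable[measurable]: "a \<in> borel_measurable leb01"
    and weight_pos: "x \<in> {0<..<1} \<Longrightarrow> 0 < a x"
begin

lemma subspace_L2w: "subspace (L2w a)"
proof (rule subspaceI)
  have "integrable leb01 (\<lambda>x. (rep_aefun 0 x)\<^sup>2 / a x)"
    by (rule Bochner_Integration.integrable_cong_AE_imp[of _ "\<lambda>_. 0"])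
      (use rep_aefun_zero in \<open>auto elim: eventually_mono\<close>)
  then show "0 \<in> L2w a" using subspace_0[OF subspace_L2] by (simp add: L2w_def)
next
  fix u v assume uv: "u \<in> L2w a" "v \<in> L2w a"
  then have i: "integrable leb01 (\<lambda>x. 2 * ((rep_aefun u x)\<^sup>2 / a x) + 2 * ((rep_aefun v x)\<^sup>2 / a x))"
    by (intro Bochner_Integration.integrable_add integrable_mult_right) (auto simp: L2w_def)
  have "integrable leb01 (\<lambda>x. (rep_aefun (u + v) x)\<^sup>2 / a x)"
    using i
  proof (rule Bochner_Integration.integrable_bound)
    show "AE x in leb01. norm ((rep_aefun (u + v) x)\<^sup>2 / a x)
        \<le> norm (2 * ((rep_aefun u x)\<^sup>2 / a x) + 2 * ((rep_aefun v x)\<^sup>2 / a x))"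
      using rep_aefun_add[of u v] AE_space
    proof eventually_elim
      case (elim x)
      have "(r + s)\<^sup>2 \<le> 2 * r\<^sup>2 + 2 * s\<^sup>2" for r s :: real
        using sum_squares_bound[of r s] by (simp add: power2_sum)
      moreover have "a x > 0" using weight_pos[of x] elim by simp
      ultimately have "(rep_aefun (u + v) x)\<^sup>2 / a x
          \<le> (2 * (rep_aefun u x)\<^sup>2 + 2 * (rep_aefun v x)\<^sup>2) / a x"
        using elim by (intro divide_right_mono) auto
      then show ?case using \<open>a x > 0\<close> by (simp add: add_divide_distrib)
    qed
  qed measurable
  then show "u + v \<in> L2w a" using uv subspace_add[OF subspace_L2] by (auto simp: L2w_def)
next
  fix c u assume u: "u \<in> L2w a"
  then have "integrable leb01 (\<lambda>x. c\<^sup>2 * ((rep_aefun u x)\<^sup>2 / a x))"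
    by (intro integrable_mult_right) (auto simp: L2w_def)
  then have "integrable leb01 (\<lambda>x. (rep_aefun (c *\<^sub>R u) x)\<^sup>2 / a x)"
    by (rule Bochner_Integration.integrable_cong_AE_imp)
      (use rep_aefun_scaleR[of c u] in \<open>auto elim!: eventually_mono simp: power_mult_distrib\<close>)
  then show "c *\<^sub>R u \<in> L2w a" using u subspace_scale[OF subspace_L2] by (auto simp: L2w_def)
qed

lemma L2w_product_integrable:
  assumes "u \<in> L2w a" "v \<in> L2w a"
  shows "integrable leb01 (\<lambda>x. rep_aefun u x * rep_aefun v x / a x)"
proof (rule Bochner_Integration.integrable_bound)
  show "integrable leb01 (\<lambda>x. (rep_aefun u x)\<^sup>2 / a x + (rep_aefun v x)\<^sup>2 / a x)"
    using assms by (auto simp: L2w_def)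
  show "AE x in leb01. norm (rep_aefun u x * rep_aefun v x / a x)
      \<le> norm ((rep_aefun u x)\<^sup>2 / a x + (rep_aefun v x)\<^sup>2 / a x)"
    using AE_space
  proof eventually_elim
    case (elim x)
    have a: "a x > 0" using weight_pos[of x] elim by simp
    have "\<bar>r * s\<bar> \<le> r\<^sup>2 + s\<^sup>2" for r s :: real
      using sum_squares_bound[of "\<bar>r\<bar>" "\<bar>s\<bar>"] mult_nonneg_nonneg[of "\<bar>r\<bar>" "\<bar>s\<bar>"]
      unfolding abs_mult power2_abs by linarith
    then have "\<bar>rep_aefun u x * rep_aefun v x\<bar> / a x \<le> ((rep_aefun u x)\<^sup>2 + (rep_aefun v x)\<^sup>2) / a x"
      using a by (intro divide_right_mono) auto
    then show ?case using a by (simp add: add_divide_distrib)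
  qed
qed measurable

lemma semi_inner_L2w: "semi_inner_on (L2w a) (L2w_inner a)"
proof
  fix u v w c assume uv: "u \<in> L2w a" "v \<in> L2w a"
  show "L2w_inner a u v = L2w_inner a v u" by (simp add: L2w_inner_def mult.commute)
  show "L2w_inner a (c *\<^sub>R u) v = c * L2w_inner a u v"
    using integral_rep_aefun_scaleR[of "\<lambda>x. rep_aefun v x / a x" c u] by (simp add: L2w_inner_def)
  assume w: "w \<in> L2w a"
  show "L2w_inner a (u + v) w = L2w_inner a u w + L2w_inner a v w"
    using integral_rep_aefun_add[of u "\<lambda>x. rep_aefun w x / a x" v]
      L2w_product_integrable[OF uv(1) w] L2w_product_integrable[OF uv(2) w] by (simp add: L2w_inner_def)
next
  fix u assume u: "u \<in> L2w a"
  have "AE x in leb01. 0 \<le> rep_aefun u x * rep_aefun u x / a x"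
    using AE_space by eventually_elim (use weight_pos in \<open>auto intro!: divide_nonneg_pos\<close>)
  then show "0 \<le> L2w_inner a u u" unfolding L2w_inner_def by (rule integral_nonneg_AE)
qed (rule subspace_L2w)

lemma seminorm_L2w: "seminorm_on (L2w a) (L2w_norm a)"
proof -
  interpret semi_inner_on "L2w a" "L2w_inner a" by (rule semi_inner_L2w)
  show ?thesis using seminorm_on_axioms by (simp add: L2w_norm_def[abs_def])
qed

lemma subspace_H2w0: "subspace (H2w0 a)"
proof (rule subspaceI)
  show "0 \<in> H2w0 a"
    using subspace_0[OF subspace_L2w] subspace_0[OF subspace_H2]
    by (simp add: H2w0_def wderiv_zero bdry_val_zero)
  show "u + v \<in> H2w0 a" if "u \<in> H2w0 a" "v \<in> H2w0 a" for u v
    using that subspace_add[OF subspace_L2w] subspace_add[OF subspace_H2] H2_bdry_val_add[of u v 0]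
    by (auto simp: H2w0_def)
  show "c *\<^sub>R u \<in> H2w0 a" if "u \<in> H2w0 a" for c u
    using that subspace_scale[OF subspace_L2w] subspace_scale[OF subspace_H2] H2_bdry_val_scaleR[of u 0]
    by (auto simp: H2w0_def)
qed

lemma subspace_H0: "subspace (H0 a)"
  unfolding H0_def using subspace_H2w0 subspace_L2w by (rule subspace_Times)

end

text \<open>The locale asks for less than degeneracy, so the constant weight fits although it does
  not vanish at 0. The unweighted space thereby inherits everything proved for the weighted
  ones.\<close>

interpretation unit_weight: weight "\<lambda>_. 1"
  by unfold_locales auto

lemma L2w_unit: "L2w (\<lambda>_. 1) = L2"
  by (auto simp: L2w_def L2_def)

text \<open>The polarisation of the square of \<open>H0_norm\<close>; the triangle inequality
  follows from Cauchy-Schwarz for this form. The curvature term is written with weight 1 so that the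
  same bilinearity facts cover both integrals.\<close>

definition H0_inner ::
  "(real \<Rightarrow> real) \<Rightarrow> real \<Rightarrow> real \<Rightarrow> aefun \<times> aefun \<Rightarrow> aefun \<times> aefun \<Rightarrow> real" where
  "H0_inner a \<beta> \<gamma> Y Z =
     L2w_inner (\<lambda>_. 1) ((wderiv ^^ 2) (fst Y)) ((wderiv ^^ 2) (fst Z)) + L2w_inner a (snd Y) (snd Z)
     + \<beta> * (bdry_val (fst Y) 1 * bdry_val (fst Z) 1)
     + \<gamma> * (bdry_val (wderiv (fst Y)) 1 * bdry_val (wderiv (fst Z)) 1)"

lemma H0_norm_eq: "H0_norm a \<beta> \<gamma> Y = sqrt (H0_inner a \<beta> \<gamma> Y Y)"
  by (simp add: H0_norm_def H0_inner_def L2w_inner_def power2_eq_square split: prod.split)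

context weight
begin

lemma semi_inner_H0:
  assumes "\<beta> \<ge> 0" "\<gamma> \<ge> 0"
  shows "semi_inner_on (H0 a) (H0_inner a \<beta> \<gamma>)"
proof
  interpret one: semi_inner_on L2 "L2w_inner (\<lambda>_. 1)"
    using unit_weight.semi_inner_L2w by (simp add: L2w_unit)
  interpret semi_inner_on "L2w a" "L2w_inner a" by (rule semi_inner_L2w)
  have mem: "fst Y \<in> H2" "snd Y \<in> L2w a" "(wderiv ^^ 2) (fst Y) \<in> L2" if "Y \<in> H0 a" for Y
    using that H2_D by (auto simp: H0_def H2w0_def)
  fix X Y Z c assume XY: "X \<in> H0 a" "Y \<in> H0 a"
  show "H0_inner a \<beta> \<gamma> X Y = H0_inner a \<beta> \<gamma> Y X"
    using XY mem by (simp add: H0_inner_def sym one.sym mult.commute)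
  show "H0_inner a \<beta> \<gamma> (c *\<^sub>R X) Y = c * H0_inner a \<beta> \<gamma> X Y"
    using XY mem
    by (simp add: H0_inner_def scale_left one.scale_left H2_wderiv_scaleR(2) H2_bdry_val_scaleR algebra_simps)
  show "H0_inner a \<beta> \<gamma> (X + Y) Z = H0_inner a \<beta> \<gamma> X Z + H0_inner a \<beta> \<gamma> Y Z" if "Z \<in> H0 a"
    using XY mem that
    by (simp add: H0_inner_def add_left one.add_left H2_wderiv_add(2) H2_bdry_val_add algebra_simps)
next
  interpret one: semi_inner_on L2 "L2w_inner (\<lambda>_. 1)"
    using unit_weight.semi_inner_L2w by (simp add: L2w_unit)
  interpret semi_inner_on "L2w a" "L2w_inner a" by (rule semi_inner_L2w)
  fix Y assume "Y \<in> H0 a"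
  then have mem: "fst Y \<in> H2" "snd Y \<in> L2w a" "(wderiv ^^ 2) (fst Y) \<in> L2"
    using H2_D by (auto simp: H0_def H2w0_def)
  then show "0 \<le> H0_inner a \<beta> \<gamma> Y Y"
    unfolding H0_inner_def using assms
    by (intro add_nonneg_nonneg nonneg one.nonneg mult_nonneg_nonneg zero_le_square)
qed (rule subspace_H0)

lemma seminorm_H0:
  assumes "\<beta> \<ge> 0" "\<gamma> \<ge> 0"
  shows "seminorm_on (H0 a) (H0_norm a \<beta> \<gamma>)"
proof -
  interpret semi_inner_on "H0 a" "H0_inner a \<beta> \<gamma>" by (rule semi_inner_H0[OF assms])
  show ?thesis using seminorm_on_axioms by (simp add: H0_norm_eq[abs_def])
qed

text \<open>The delay term, the nonlinearity and \<psi> all have first component 0, so their energy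
  norms reduce to weighted norms.\<close>

lemma H0_norm_Pair_zero: "H0_norm a \<beta> \<gamma> (0, v) = L2w_norm a v"
proof -
  interpret one: semi_inner_on L2 "L2w_inner (\<lambda>_. 1)"
    using unit_weight.semi_inner_L2w by (simp add: L2w_unit)
  have "L2w_inner (\<lambda>_. 1) 0 0 = 0"
    using one.scale_left[of 0 0 0] subspace_0[OF subspace_L2] by simp
  then show ?thesis
    by (simp add: H0_norm_eq H0_inner_def L2w_norm_def numeral_2_eq_2 wderiv_zero bdry_val_zero)
qed

text \<open>The remaining summands are nonnegative. The first bound places the displacement in the
  ball where \<open>f\<close> is Lipschitz; the second controls the velocity entering the delay
  term.\<close>

lemma H0_norm_components:
  assumes "Y \<in> H0 a" "\<beta> \<ge> 0" "\<gamma> \<ge> 0"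
  shows "L2_norm ((wderiv ^^ 2) (fst Y)) \<le> H0_norm a \<beta> \<gamma> Y" "L2w_norm a (snd Y) \<le> H0_norm a \<beta> \<gamma> Y"
proof -
  interpret one: semi_inner_on L2 "L2w_inner (\<lambda>_. 1)"
    using unit_weight.semi_inner_L2w by (simp add: L2w_unit)
  interpret semi_inner_on "L2w a" "L2w_inner a" by (rule semi_inner_L2w)
  have mem: "snd Y \<in> L2w a" "(wderiv ^^ 2) (fst Y) \<in> L2"
    using assms(1) H2_D by (auto simp: H0_def H2w0_def)
  have "0 \<le> \<beta> * (bdry_val (fst Y) 1 * bdry_val (fst Y) 1)"
    "0 \<le> \<gamma> * (bdry_val (wderiv (fst Y)) 1 * bdry_val (wderiv (fst Y)) 1)"
    using assms by auto
  then show "L2_norm ((wderiv ^^ 2) (fst Y)) \<le> H0_norm a \<beta> \<gamma> Y" "L2w_norm a (snd Y) \<le> H0_norm a \<beta> \<gamma> Y"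
    using nonneg[OF mem(1)] one.nonneg[OF mem(2)]
    unfolding H0_norm_eq H0_inner_def L2w_norm_def
    by (auto simp: L2_norm_def L2w_inner_def power2_eq_square)
qed

end

lemma weight_WD_SD:
  assumes "WD a \<or> SD a"
  shows "weight a"
proof
  have "continuous_on {0<..<1} a"
    using assms
    by (auto simp: WD_def SD_def C1_on_def intro: continuous_on_subset
        dest!: differentiable_imp_continuous_on)
  then show "a \<in> borel_measurable leb01" by (rule continuous_on_measurable_leb01)
  show "0 < a x" if "x \<in> {0<..<1}" for x
    using assms that by (auto simp: WD_def SD_def)
qed

section \<open>Bochner integrals and Gronwall's inequality\<close>

context seminorm_on
begin

lemma simple_bochner_integral_bound:
  assumes s: "Bochner_Integration.simple_bochner_integrable M s" "s ` space M \<subseteq> V"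
  shows "Bochner_Integration.simple_bochner_integral M s \<in> V"
    "ennreal (N (Bochner_Integration.simple_bochner_integral M s)) \<le> (\<integral>\<^sup>+x. ennreal (N (s x)) \<partial>M)"
proof -
  have sf: "simple_function M s" and fin: "emeasure M {x \<in> space M. s x \<noteq> 0} \<noteq> \<infinity>"
    using s(1) by (auto elim: simple_bochner_integrable.cases)
  \<comment> \<open>\<open>N\<close> is known to be nonnegative on \<open>V\<close> only, whereas
    the passage to the nonnegative integral asks for it at every point; hence the absolute
    value.\<close>
  have sbN: "Bochner_Integration.simple_bochner_integrable M (\<lambda>x. \<bar>N (s x)\<bar>)"
  proof
    show "simple_function M (\<lambda>x. \<bar>N (s x)\<bar>)"
      using sf by (rule simple_function_compose1)
    have "emeasure M {x \<in> space M. \<bar>N (s x)\<bar> \<noteq> 0} \<le> emeasure M {x \<in> space M. s x \<noteq> 0}"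
      using sf zero by (intro emeasure_mono) (auto intro: simple_functionD)
    then show "emeasure M {x \<in> space M. \<bar>N (s x)\<bar> \<noteq> 0} \<noteq> \<infinity>" using fin
      by (auto simp: top_unique)
  qed
  show "Bochner_Integration.simple_bochner_integral M s \<in> V"
    unfolding simple_bochner_integral_def using s(2)
    by (intro subspace_sum[OF subspace] subspace_scale[OF subspace]) auto
  have "N (Bochner_Integration.simple_bochner_integral M s)
      \<le> (\<Sum>y\<in>s ` space M. N (measure M {x \<in> space M. s x = y} *\<^sub>R y))"
    unfolding simple_bochner_integral_def using s(2)
    by (intro sum_le subspace_scale[OF subspace]) auto
  also have "\<dots> = (\<Sum>y\<in>s ` space M. measure M {x \<in> space M. s x = y} *\<^sub>R \<bar>N y\<bar>)"
    using s(2) nonneg by (intro sum.cong) (auto simp: scale)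
  also have "\<dots> = Bochner_Integration.simple_bochner_integral M (\<lambda>x. \<bar>N (s x)\<bar>)"
    by (rule simple_bochner_integral_partition[OF sbN sf, symmetric]) auto
  finally have "ennreal (N (Bochner_Integration.simple_bochner_integral M s))
      \<le> ennreal (Bochner_Integration.simple_bochner_integral M (\<lambda>x. \<bar>N (s x)\<bar>))"
    by (rule ennreal_leI)
  also have "\<dots> = (\<integral>\<^sup>+x. ennreal \<bar>N (s x)\<bar> \<partial>M)"
    by (rule simple_bochner_integral_eq_nn_integral[OF sbN]) simp
  also have "\<dots> = (\<integral>\<^sup>+x. ennreal (N (s x)) \<partial>M)"
    using s(2) nonneg by (intro nn_integral_cong) auto
  finally show "ennreal (N (Bochner_Integration.simple_bochner_integral M s)) \<le> (\<integral>\<^sup>+x. ennreal (N (s x)) \<partial>M)" .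
qed

text \<open>Compare z with the integrals of the approximating simple functions, whose norms are at
  most \<open>G\<close> plus the approximation error. A majorant \<open>G\<close> in place of the
  norm of \<open>F\<close> itself matches the use made of it: the integrands of the mild formulation
  are estimated pointwise by explicit integrable functions.\<close>

lemma has_bochner_integral_on_bound:
  assumes F: "has_bochner_integral_on V N M F z"
    and bound: "\<And>x. x \<in> space M \<Longrightarrow> N (F x) \<le> G x" and G: "integrable M G"
  shows "N z \<le> (\<integral>x. G x \<partial>M)"
proof -
  obtain s where s: "\<And>i. Bochner_Integration.simple_bochner_integrable M (s i)" "\<And>i. s i ` space M \<subseteq> V"
      "\<And>i. (\<lambda>x. N (F x - s i x)) \<in> borel_measurable M"
    and lim1: "(\<lambda>i. \<integral>\<^sup>+x. ennreal (N (F x - s i x)) \<partial>M) \<longlonglongrightarrow> 0"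
    and lim2: "(\<lambda>i. N (Bochner_Integration.simple_bochner_integral M (s i) - z)) \<longlonglongrightarrow> 0"
    and FV: "\<And>x. x \<in> space M \<Longrightarrow> F x \<in> V" and z: "z \<in> V"
    using F unfolding has_bochner_integral_on_def by blast
  note [measurable] = s(3) borel_measurable_integrable[OF G]
  have G0: "0 \<le> G x" if "x \<in> space M" for x
    using bound[OF that] nonneg[OF FV[OF that]] by simp
  let ?I = "\<lambda>i. Bochner_Integration.simple_bochner_integral M (s i)"
  \<comment> \<open>Stated in extended nonnegative reals because the error integrals tend to 0 but
    may be infinite for small i.\<close>
  have le: "ennreal (N z) \<le> ennreal (N (?I i - z)) + (ennreal (\<integral>x. G x \<partial>M) + (\<integral>\<^sup>+x. ennreal (N (F x - s i x)) \<partial>M))" for i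
  proof -
    note I = simple_bochner_integral_bound[OF s(1,2), of i]
    have "N z \<le> N (?I i - z) + N (?I i)"
      using triangle_diff[OF z I(1)] minus_commute[OF z I(1)] by simp
    then have "ennreal (N z) \<le> ennreal (N (?I i - z)) + ennreal (N (?I i))"
      using nonneg[OF I(1)] nonneg[OF subspace_diff[OF subspace I(1) z]]
      by (simp add: ennreal_leI flip: ennreal_plus)
    moreover have "ennreal (N (?I i)) \<le> (\<integral>\<^sup>+x. ennreal (G x) + ennreal (N (F x - s i x)) \<partial>M)"
    proof (rule order_trans[OF I(2) nn_integral_mono])
      fix x assume x: "x \<in> space M"
      then have sx: "s i x \<in> V" using s(2) by auto
      have "N (s i x) \<le> N (F x - s i x) + N (F x)"
        using triangle_diff[OF sx FV[OF x]] minus_commute[OF sx FV[OF x]] by simp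
      also have "\<dots> \<le> G x + N (F x - s i x)" using bound[OF x] by simp
      finally show "ennreal (N (s i x)) \<le> ennreal (G x) + ennreal (N (F x - s i x))"
        using G0[OF x] nonneg[OF subspace_diff[OF subspace FV[OF x] sx]]
        by (simp add: ennreal_leI flip: ennreal_plus)
    qed
    moreover have "(\<integral>\<^sup>+x. ennreal (G x) + ennreal (N (F x - s i x)) \<partial>M)
        = (\<integral>\<^sup>+x. ennreal (G x) \<partial>M) + (\<integral>\<^sup>+x. ennreal (N (F x - s i x)) \<partial>M)"
      by (rule nn_integral_add) measurable
    moreover have "(\<integral>\<^sup>+x. ennreal (G x) \<partial>M) = ennreal (\<integral>x. G x \<partial>M)"
      using G0 by (intro nn_integral_eq_integral G) auto
    ultimately show ?thesis by (metis (no_types, lifting) add_left_mono order_trans)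
  qed
  have "(\<lambda>i. ennreal (N (?I i - z)) + (ennreal (\<integral>x. G x \<partial>M) + (\<integral>\<^sup>+x. ennreal (N (F x - s i x)) \<partial>M)))
      \<longlonglongrightarrow> ennreal 0 + (ennreal (\<integral>x. G x \<partial>M) + 0)"
    by (intro tendsto_add tendsto_const tendsto_ennrealI lim1 lim2)
  then have "ennreal (N z) \<le> ennreal 0 + (ennreal (\<integral>x. G x \<partial>M) + 0)"
    by (rule LIMSEQ_le_const) (use le in auto)
  moreover have "0 \<le> (\<integral>x. G x \<partial>M)"
    using G0 by (intro integral_nonneg_AE) auto
  ultimately show ?thesis by simp
qed

end

section \<open>Gronwall's inequality with an integrable kernel\<close>

lemma Gronwall_discrete_step:
  fixes K R :: "real \<Rightarrow> real"
  assumes cont: "continuous_on {0..b} K"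
    and step: "\<And>s t. 0 \<le> s \<Longrightarrow> s \<le> t \<Longrightarrow> t \<le> b \<Longrightarrow> R t * (1 - (K t - K s)) \<le> R s"
    and \<delta>: "0 \<le> \<delta>" "\<delta> \<le> 1"
  shows "0 \<le> s \<Longrightarrow> s \<le> t \<Longrightarrow> t \<le> b \<Longrightarrow> K t - K s = real n * \<delta> \<Longrightarrow> R t * (1 - \<delta>) ^ n \<le> R s"
proof (induction n arbitrary: t)
  case 0
  then show ?case using step[of s t] by simp
next
  case (Suc n)
  \<comment> \<open>Continuity of \<open>K\<close> lets the last piece of mass
    \<open>\<delta>\<close> be split off by the intermediate value theorem; crossing it costs one
    factor 1 - \<open>\<delta>\<close>.\<close>
  have "\<exists>r\<ge>s. r \<le> t \<and> K r = K s + real n * \<delta>"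
    using Suc.prems \<delta>
    by (intro IVT' continuous_on_subset[OF cont]) (auto simp: algebra_simps)
  then obtain r where r: "s \<le> r" "r \<le> t" "K r = K s + real n * \<delta>" by blast
  have "R t * (1 - \<delta>) \<le> R r"
    using step[of r t] r Suc.prems by (simp add: algebra_simps)
  then have "R t * (1 - \<delta>) * (1 - \<delta>) ^ n \<le> R r * (1 - \<delta>) ^ n"
    using \<delta> by (intro mult_right_mono) auto
  also have "\<dots> \<le> R s" using Suc.IH[of r] r Suc.prems by simp
  finally show ?case by simp
qed

text \<open>Chopping \<open>[0, b]\<close> into \<open>n\<close> pieces carrying the same mass of \<open>\<kappa>\<close> reduces the claim to
  \<open>(1 - K / n) ^ n \<longlonglongrightarrow> exp (- K)\<close>; this needs no differentiability of the primitive of \<open>\<kappa>\<close>.\<close>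

lemma Gronwall_integrable_kernel:
  fixes \<phi> \<kappa> :: "real \<Rightarrow> real"
  assumes b: "0 \<le> b" and A: "0 \<le> A"
    and \<kappa>: "\<kappa> absolutely_integrable_on {0..b}" "\<And>s. s \<in> {0..b} \<Longrightarrow> 0 \<le> \<kappa> s"
    and \<phi>: "continuous_on {0..b} \<phi>" "\<And>s. s \<in> {0..b} \<Longrightarrow> 0 \<le> \<phi> s"
    and le: "\<And>s. s \<in> {0..b} \<Longrightarrow> \<phi> s \<le> A + integral {0..s} (\<lambda>r. \<kappa> r * \<phi> r)"
  shows "\<phi> b \<le> A * exp (integral {0..b} \<kappa>)"
proof -
  define K where "K s = integral {0..s} \<kappa>" for s
  define R where "R s = A + integral {0..s} (\<lambda>r. \<kappa> r * \<phi> r)" for s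
  have "(\<lambda>r. \<phi> r * \<kappa> r) absolutely_integrable_on {0..b}"
    using \<phi>(1) \<kappa>(1)
    by (intro absolutely_integrable_bounded_measurable_product_real)
      (auto intro!: continuous_imp_measurable_on_sets_lebesgue compact_imp_bounded compact_continuous_image)
  then have ip: "(\<lambda>r. \<kappa> r * \<phi> r) integrable_on {0..b}"
    by (simp add: mult.commute set_lebesgue_integral_eq_integral(1))
  have ik: "\<kappa> integrable_on {0..b}"
    using \<kappa>(1) by (rule set_lebesgue_integral_eq_integral(1))
  have ip': "(\<lambda>r. \<kappa> r * \<phi> r) integrable_on {s..t}" and ik': "\<kappa> integrable_on {s..t}"
    if "0 \<le> s" "t \<le> b" for s t
    using that by (auto intro: integrable_on_subinterval[OF ip] integrable_on_subinterval[OF ik])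
  have dK: "K t - K s = integral {s..t} \<kappa>" if "0 \<le> s" "s \<le> t" "t \<le> b" for s t
    using Henstock_Kurzweil_Integration.integral_combine[OF that(1,2) ik'[of 0 t]] that by (simp add: K_def)
  have dR: "R t - R s = integral {s..t} (\<lambda>r. \<kappa> r * \<phi> r)" if "0 \<le> s" "s \<le> t" "t \<le> b" for s t
    using Henstock_Kurzweil_Integration.integral_combine[OF that(1,2) ip'[of 0 t]] that by (simp add: R_def)
  have K_mono: "K s \<le> K t" if "0 \<le> s" "s \<le> t" "t \<le> b" for s t
  proof -
    have "0 \<le> integral {s..t} \<kappa>"
      using that \<kappa>(2) by (intro Henstock_Kurzweil_Integration.integral_nonneg ik') auto
    then show ?thesis using dK[OF that] by simp
  qed
  have R_mono: "R s \<le> R t" if "0 \<le> s" "s \<le> t" "t \<le> b" for s t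
  proof -
    have "0 \<le> integral {s..t} (\<lambda>r. \<kappa> r * \<phi> r)"
      using that \<kappa>(2) \<phi>(2) by (intro Henstock_Kurzweil_Integration.integral_nonneg ip') auto
    then show ?thesis using dR[OF that] by simp
  qed
  \<comment> \<open>As \<open>R\<close> is nondecreasing, \<open>\<phi>\<close> is at most
    \<open>R t\<close> throughout {s..t}, so the increment of \<open>R\<close> is at most that of
    \<open>K\<close> times \<open>R t\<close>. Using the right endpoint is what produces factors 1 -
    \<open>\<delta>\<close> on the left-hand side.\<close>
  have step: "R t * (1 - (K t - K s)) \<le> R s" if st: "0 \<le> s" "s \<le> t" "t \<le> b" for s t
  proof -
    have "R t - R s \<le> integral {s..t} (\<lambda>r. \<kappa> r * R t)"
      unfolding dR[OF st]
    proof (rule integral_le)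
      show "(\<lambda>r. \<kappa> r * \<phi> r) integrable_on {s..t}" using st by (intro ip') auto
      show "(\<lambda>r. \<kappa> r * R t) integrable_on {s..t}" using st by (intro integrable_on_mult_left ik') auto
      fix r assume r: "r \<in> {s..t}"
      then have "\<phi> r \<le> R r" using le[of r] st by (simp add: R_def)
      also have "\<dots> \<le> R t" using r st by (intro R_mono) auto
      finally show "\<kappa> r * \<phi> r \<le> \<kappa> r * R t"
        using \<kappa>(2)[of r] r st by (intro mult_left_mono) auto
    qed
    also have "\<dots> = (K t - K s) * R t" using st by (simp add: dK)
    finally show ?thesis by (simp add: algebra_simps)
  qed
  have K0: "K 0 = 0" "R 0 = A" by (simp_all add: K_def R_def)
  have Kb: "0 \<le> K b" using K_mono[of 0 b] b K0 by simp
  have K_cont: "continuous_on {0..b} K"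
    unfolding K_def[abs_def] by (rule indefinite_integral_continuous_1[OF ik])
  have "R b * exp (- K b) \<le> A"
  proof (rule LIMSEQ_le_const2)
    show "(\<lambda>n. R b * (1 + (- K b) / real n) ^ n) \<longlonglongrightarrow> R b * exp (- K b)"
      by (intro tendsto_mult tendsto_const tendsto_exp_limit_sequentially)
    \<comment> \<open>Beyond m the mass K b / n of one piece is at most 1, as the discrete step
      demands; n \<ge> 1 keeps the quotient meaningful.\<close>
    obtain m :: nat where m: "K b < real m" using reals_Archimedean2 by blast
    have "R b * (1 + (- K b) / real n) ^ n \<le> A" if "n \<ge> max m 1" for n
    proof -
      have n: "K b \<le> real n" "0 < real n" using m that by auto
      have "R b * (1 - K b / real n) ^ n \<le> R 0"
        by (rule Gronwall_discrete_step[OF K_cont step])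
          (use n Kb b K0 in \<open>auto simp: divide_le_eq_1_pos\<close>)
      then show ?thesis using K0 by simp
    qed
    then show "\<exists>N. \<forall>n\<ge>N. R b * (1 + (- K b) / real n) ^ n \<le> A" by blast
  qed
  then have "R b \<le> A * exp (K b)"
    by (simp add: exp_minus field_simps)
  moreover have "\<phi> b \<le> R b" using le[of b] b by (simp add: R_def)
  ultimately show ?thesis by (simp add: K_def)
qed

section \<open>The delayed problem\<close>

text \<open>Boundedness of \<open>F\<close> enters twice: it makes the supremum finite, and it
  settles vectors with N x = 0, where the quotient is 0 by convention and the supremum carries no
  information.\<close>

lemma onorm_on_bound:
  assumes F: "bounded_linear_on V N W N' F" and N: "\<And>x. x \<in> V \<Longrightarrow> 0 \<le> N x"
    and x: "x \<in> V"
  shows "N' (F x) \<le> onorm_on V N N' F * N x"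
proof -
  obtain C where "\<forall>x\<in>V. N' (F x) \<le> C * N x"
    using F unfolding bounded_linear_on_def by blast
  then have C: "\<And>x. x \<in> V \<Longrightarrow> N' (F x) \<le> C * N x" by blast
  have "bdd_above ((\<lambda>x. N' (F x) / N x) ` V)"
  proof (rule bdd_aboveI2)
    fix x assume "x \<in> V"
    then show "N' (F x) / N x \<le> \<bar>C\<bar>"
      using C[of x] N[of x] by (cases "N x = 0") (auto simp: divide_le_eq intro: order_trans mult_right_mono)
  qed
  then have le: "N' (F x) / N x \<le> onorm_on V N N' F"
    unfolding onorm_on_def using x by (rule cSUP_upper[rotated])
  show ?thesis
  proof (cases "N x = 0")
    case True
    then show ?thesis using C[OF x] by simp
  next
    case False
    then show ?thesis using le N[OF x] by (simp add: divide_le_eq)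
  qed
qed

section \<open>Measurability and integrability of the memory term\<close>

lemma borel_measurable_AE_LIMSEQ:
  fixes f :: "nat \<Rightarrow> real \<Rightarrow> real"
  assumes I: "I \<in> sets lebesgue" and f: "\<And>i. f i \<in> borel_measurable (lebesgue_on I)"
    and lim: "AE x in lebesgue_on I. (\<lambda>i. f i x) \<longlonglongrightarrow> h x"
  shows "h \<in> borel_measurable (lebesgue_on I)"
proof -
  have I': "I \<inter> space lebesgue \<in> sets lebesgue" using I by simp
  \<comment> \<open>\<open>lim\<close> is measurable even where the sequence diverges; it agrees
    with \<open>h\<close> off a null set, and completeness of Lebesgue measure transfers
    measurability.\<close>
  have "(\<lambda>x. lim (\<lambda>i. f i x)) \<in> borel_measurable (lebesgue_on I)"
    using f by (rule borel_measurable_lim_metric)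
  then have "(\<lambda>x. indicator I x *\<^sub>R lim (\<lambda>i. f i x)) \<in> borel_measurable lebesgue"
    by (subst (asm) borel_measurable_restrict_space_iff[OF I'])
  moreover have "AE x in lebesgue. x \<in> I \<longrightarrow> (\<lambda>i. f i x) \<longlonglongrightarrow> h x"
    using lim by (subst (asm) AE_restrict_space_iff[OF I'])
  then have "AE x in lebesgue. indicator I x *\<^sub>R lim (\<lambda>i. f i x) = indicator I x *\<^sub>R h x"
    by (rule eventually_mono) (auto simp: indicator_def limI)
  ultimately have "(\<lambda>x. indicator I x *\<^sub>R h x) \<in> borel_measurable lebesgue"
    by (rule borel_measurable_AE)
  then show ?thesis by (subst borel_measurable_restrict_space_iff[OF I'])
qed

text \<open>A simple function stays simple under any map and continuity of \<open>n\<close>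
  preserves the limit, so no Borel structure on the values of \<open>g\<close> has to be
  discussed.\<close>

lemma strongly_measurable_on_compose:
  fixes n :: "'h::real_normed_vector \<Rightarrow> real"
  assumes g: "strongly_measurable_on I g" and n: "continuous_on UNIV n" and I: "I \<in> sets lebesgue"
  shows "(\<lambda>x. n (g x)) \<in> borel_measurable (lebesgue_on I)"
proof -
  obtain s where s: "\<And>i. simple_function (lebesgue_on I) (s i)"
      "AE x in lebesgue_on I. (\<lambda>i. s i x) \<longlonglongrightarrow> g x"
    using g by (auto simp: strongly_measurable_on_def)
  show ?thesis
  proof (rule borel_measurable_AE_LIMSEQ[OF I])
    show "(\<lambda>x. n (s i x)) \<in> borel_measurable (lebesgue_on I)" for i
      using simple_function_compose1[OF s(1), of n] by (rule borel_measurable_simple_function)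
    show "AE x in lebesgue_on I. (\<lambda>i. n (s i x)) \<longlonglongrightarrow> n (g x)"
      using s(2) by (rule eventually_mono) (rule continuous_on_tendsto_compose[OF n]; simp)
  qed
qed

lemma measurable_lebesgue_on_shift:
  fixes f :: "real \<Rightarrow> real"
  assumes "f \<in> borel_measurable (lebesgue_on {p..q})"
  shows "(\<lambda>x. f (x - c)) \<in> borel_measurable (lebesgue_on {p + c..q + c})"
proof -
  have "(\<lambda>x. indicator {p..q} x *\<^sub>R f x) \<in> borel_measurable lebesgue"
    using assms by (subst (asm) borel_measurable_restrict_space_iff) auto
  moreover have "(\<lambda>x. - c + 1 * x) \<in> lebesgue \<rightarrow>\<^sub>M lebesgue"
    using lebesgue_affine_measurable[where c="\<lambda>x::real. 1" and t="- c"] by simp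
  ultimately have "(\<lambda>x. indicator {p..q} (- c + 1 * x) *\<^sub>R f (- c + 1 * x)) \<in> borel_measurable lebesgue"
    by (rule measurable_compose_rev)
  moreover have "indicator {p..q} (- c + 1 * x) *\<^sub>R f (- c + 1 * x) = indicator {p + c..q + c} x *\<^sub>R f (x - c)" for x
    by (auto simp: indicator_def algebra_simps)
  ultimately have "(\<lambda>x. indicator {p + c..q + c} x *\<^sub>R f (x - c)) \<in> borel_measurable lebesgue"
    by (simp only:)
  then show ?thesis by (subst borel_measurable_restrict_space_iff) auto
qed

lemma set_integrable_lebesgue_shift:
  fixes f :: "real \<Rightarrow> real"
  assumes "set_integrable lebesgue {p + c..q + c} f"
  shows "set_integrable lebesgue {p..q} (\<lambda>x. f (x + c))"
proof -
  have "integrable lebesgue (\<lambda>x. indicator {p + c..q + c} (c + 1 * x) *\<^sub>R f (c + 1 * x))"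
    using assms unfolding set_integrable_def by (subst lebesgue_integrable_real_affine_iff) auto
  moreover have "indicator {p + c..q + c} (c + 1 * x) *\<^sub>R f (c + 1 * x) = indicator {p..q} x *\<^sub>R f (x + c)" for x
    by (auto simp: indicator_def algebra_simps)
  ultimately show ?thesis unfolding set_integrable_def by (simp only:)
qed

context weight
begin

text \<open>The reverse triangle inequality makes this real function Lipschitz. Composed with a
  strongly measurable \<open>g\<close> it gives the measurability of the history term.\<close>

lemma L2w_norm_B_continuous:
  fixes B :: "'h::real_normed_vector \<Rightarrow> aefun"
  assumes B: "bounded_linear_on UNIV norm (L2w a) (L2w_norm a) B"
  shows "continuous_on UNIV (\<lambda>x. L2w_norm a (B x))"
proof -
  interpret w: seminorm_on "L2w a" "L2w_norm a" by (rule seminorm_L2w)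
  have BW: "B x \<in> L2w a" and add: "B (x + y) = B x + B y" and sc: "B (c *\<^sub>R x) = c *\<^sub>R B x" for x y c
    using B by (auto simp: bounded_linear_on_def)
  have diff: "B (x - y) = B x - B y" for x y
    using add[of x "(-1) *\<^sub>R y"] sc[of "-1" y] by simp
  define C where "C = onorm_on UNIV norm (L2w_norm a) B"
  have C: "L2w_norm a (B x) \<le> C * norm x" for x
    unfolding C_def by (rule onorm_on_bound[OF B]) auto
  have diff_le: "\<bar>L2w_norm a (B y) - L2w_norm a (B x)\<bar> \<le> C * norm (y - x)" for x y
    using w.abs_diff_le[OF BW BW, of y x] C[of "y - x"] by (simp add: diff)
  have "((\<lambda>y. L2w_norm a (B y) - L2w_norm a (B x)) \<longlongrightarrow> 0) (at x)" for x
  proof (rule Lim_null_comparison)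
    show "\<forall>\<^sub>F y in at x. norm (L2w_norm a (B y) - L2w_norm a (B x)) \<le> C * norm (y - x)"
      using diff_le[of _ x] by simp
    have "((\<lambda>y. C * norm (y - x)) \<longlongrightarrow> C * norm (x - x)) (at x)" by (intro tendsto_intros)
    then show "((\<lambda>y. C * norm (y - x)) \<longlongrightarrow> 0) (at x)" by simp
  qed
  then have "((\<lambda>y. L2w_norm a (B y)) \<longlongrightarrow> L2w_norm a (B x)) (at x)" for x
    by (rule LIM_zero_cancel)
  then show ?thesis by (simp add: continuous_on_def)
qed

text \<open>Testing the adjoint identity at x = Bs v bounds the square of the norm of
  \<open>Bs v\<close> by the operator norm of \<open>B\<close> times the norms of
  \<open>Bs v\<close> and \<open>v\<close>. Cancelling one factor bounds \<open>Bs\<close>, so the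
  operator norm of \<open>B\<close> controls both maps.\<close>

lemma BBs_bound:
  fixes B :: "'h::real_inner \<Rightarrow> aefun"
  assumes B: "bounded_linear_on UNIV norm (L2w a) (L2w_norm a) B" and Bs: "is_adjoint a B Bs"
    and v: "v \<in> L2w a"
  shows "L2w_norm a (B (Bs v)) \<le> (onorm_on UNIV norm (L2w_norm a) B)\<^sup>2 * L2w_norm a v"
proof -
  interpret si: semi_inner_on "L2w a" "L2w_inner a" by (rule semi_inner_L2w)
  interpret w: seminorm_on "L2w a" "L2w_norm a" by (rule seminorm_L2w)
  define C where "C = onorm_on UNIV norm (L2w_norm a) B"
  have BW: "B x \<in> L2w a" for x using B by (auto simp: bounded_linear_on_def)
  have C: "L2w_norm a (B x) \<le> C * norm x" for x
    unfolding C_def by (rule onorm_on_bound[OF B]) auto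
  show ?thesis
  proof (cases "Bs v = 0")
    case True
    then have "L2w_norm a (B (Bs v)) \<le> 0" using C[of "Bs v"] by simp
    also have "0 \<le> C\<^sup>2 * L2w_norm a v" using w.nonneg[OF v] by simp
    finally show ?thesis by (simp add: C_def)
  next
    case False
    \<comment> \<open>The nonzero vector \<open>Bs v\<close> supplies the sign of \<open>C\<close>
      here and permits the cancellation below.\<close>
    have C0: "0 \<le> C"
      using order_trans[OF w.nonneg[OF BW] C, of "Bs v"] False by (simp add: zero_le_mult_iff)
    have "norm (Bs v) * norm (Bs v) = L2w_inner a (B (Bs v)) v"
      using Bs v by (simp add: is_adjoint_def power2_norm_eq_inner flip: power2_eq_square)
    also have "\<dots> \<le> L2w_norm a (B (Bs v)) * L2w_norm a v"
      using si.Cauchy_Schwarz[OF BW v, of "Bs v"] by (simp add: L2w_norm_def)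
    also have "\<dots> \<le> (C * norm (Bs v)) * L2w_norm a v"
      using C w.nonneg[OF v] by (rule mult_right_mono)
    finally have "norm (Bs v) * norm (Bs v) \<le> norm (Bs v) * (C * L2w_norm a v)" by (simp add: ac_simps)
    then have "norm (Bs v) \<le> C * L2w_norm a v" using False by simp
    then have "C * norm (Bs v) \<le> C * (C * L2w_norm a v)" using C0 by (rule mult_left_mono)
    then show ?thesis using C[of "Bs v"] by (simp add: C_def power2_eq_square mult.assoc)
  qed
qed

end

text \<open>The smallness condition controls the square of the norm of g against |k|; z \<le> 1 +
  z^2 together with integrability of k yields the first power. Thus the history term of the final
  bound is a genuine integral and not the default value 0.\<close>

lemma memory_integrable:
  fixes g :: "real \<Rightarrow> 'h::real_normed_vector" and n :: "'h \<Rightarrow> real"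
  assumes k: "set_integrable lebesgue {0..\<tau>} k" and g: "strongly_measurable_on {-\<tau>..0} g"
    and kg: "set_integrable lebesgue {0..\<tau>} (\<lambda>s. \<bar>k s\<bar> * (norm (g (s - \<tau>)))\<^sup>2)"
    and n: "continuous_on UNIV n" "\<And>x. 0 \<le> n x" "\<And>x. n x \<le> C * norm x"
    and e: "continuous_on {0..\<tau>} e"
  shows "set_integrable lebesgue {0..\<tau>} (\<lambda>s. e s * \<bar>k s\<bar> * n (g (s - \<tau>)))"
proof -
  have nm: "(\<lambda>s. n (g (s - \<tau>))) \<in> borel_measurable (lebesgue_on {0..\<tau>})"
    using measurable_lebesgue_on_shift[OF strongly_measurable_on_compose[OF g n(1)], of \<tau>] by simp
  have km: "k \<in> borel_measurable (lebesgue_on {0..\<tau>})"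
    using k by (rule absolutely_integrable_imp_borel_measurable) simp
  have i: "set_integrable lebesgue {0..\<tau>} (\<lambda>s. \<bar>C\<bar> * (\<bar>k s\<bar> + \<bar>k s\<bar> * (norm (g (s - \<tau>)))\<^sup>2))"
    using set_integrable_abs[OF k] kg by (intro set_integrable_mult_right set_integral_add)
  have "set_integrable lebesgue {0..\<tau>} (\<lambda>s. \<bar>k s\<bar> * n (g (s - \<tau>)))"
  proof (rule measurable_bounded_by_integrable_imp_absolutely_integrable)
    show "(\<lambda>s. \<bar>k s\<bar> * n (g (s - \<tau>))) \<in> borel_measurable (lebesgue_on {0..\<tau>})"
      using nm km by measurable
    show "(\<lambda>s. \<bar>C\<bar> * (\<bar>k s\<bar> + \<bar>k s\<bar> * (norm (g (s - \<tau>)))\<^sup>2)) integrable_on {0..\<tau>}"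
      using i by (rule set_lebesgue_integral_eq_integral(1))
    fix s assume "s \<in> {0..\<tau>}"
    let ?z = "norm (g (s - \<tau>))"
    have "n (g (s - \<tau>)) \<le> \<bar>C\<bar> * ?z"
      using n(3)[of "g (s - \<tau>)"] by (rule order_trans) (simp add: mult_right_mono)
    also have "\<dots> \<le> \<bar>C\<bar> * (1 + ?z\<^sup>2)"
    proof (rule mult_left_mono)
      show "?z \<le> 1 + ?z\<^sup>2"
        using sum_squares_bound[of 1 ?z] norm_ge_zero[of "g (s - \<tau>)"] unfolding power_one by linarith
    qed simp
    finally have "\<bar>k s\<bar> * n (g (s - \<tau>)) \<le> \<bar>k s\<bar> * (\<bar>C\<bar> * (1 + ?z\<^sup>2))" by (rule mult_left_mono) simp
    then show "norm (\<bar>k s\<bar> * n (g (s - \<tau>))) \<le> \<bar>C\<bar> * (\<bar>k s\<bar> + \<bar>k s\<bar> * ?z\<^sup>2)"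
      using n(2) by (simp add: abs_mult algebra_simps)
  qed simp
  moreover have "bounded (e ` {0..\<tau>})"
    using e by (intro compact_imp_bounded compact_continuous_image) auto
  moreover have "e \<in> borel_measurable (lebesgue_on {0..\<tau>})"
    using e by (intro continuous_imp_measurable_on_sets_lebesgue) auto
  ultimately have "set_integrable lebesgue {0..\<tau>} (\<lambda>s. e s * (\<bar>k s\<bar> * n (g (s - \<tau>))))"
    by (rule_tac absolutely_integrable_bounded_measurable_product_real) simp_all
  then show ?thesis by (simp add: mult.assoc)
qed

lemma integral_lebesgue_on_le:
  fixes G :: "real \<Rightarrow> real"
  assumes G: "integrable lebesgue G" "\<And>x. 0 \<le> G x" and I: "I \<in> sets lebesgue"
  shows "integrable (lebesgue_on I) G" "(LINT x|lebesgue_on I. G x) \<le> (LINT x|lebesgue. G x)"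
proof -
  have i: "integrable lebesgue (\<lambda>x. indicator I x *\<^sub>R G x)"
    using integrable_mult_indicator[OF I G(1)] .
  then show "integrable (lebesgue_on I) G"
    using I by (subst integrable_restrict_space) auto
  have "(LINT x|lebesgue_on I. G x) = (LINT x|lebesgue. indicator I x *\<^sub>R G x)"
    using I by (subst integral_restrict_space) auto
  also have "\<dots> \<le> (LINT x|lebesgue. G x)"
    using i G by (intro integral_mono) (auto simp: indicator_def)
  finally show "(LINT x|lebesgue_on I. G x) \<le> (LINT x|lebesgue. G x)" .
qed

section \<open>The exponential decay estimate\<close>

theorem theorem3p1:
  fixes a k h L :: "real \<Rightarrow> real"
    and \<beta> \<gamma> \<tau> \<Lambda> M \<omega> \<alpha> \<omega>' T \<rho> C\<rho> b :: real
    and S :: "real \<Rightarrow> aefun \<times> aefun \<Rightarrow> aefun \<times> aefun"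
    and B :: "'h::{real_inner, complete_space} \<Rightarrow> aefun"
    and Bs :: "aefun \<Rightarrow> 'h"
    and f :: "aefun \<Rightarrow> aefun"
    and Y0 :: "aefun \<times> aefun"
    and g :: "real \<Rightarrow> 'h"
  assumes a: "WD a \<or> SD a"
    and \<beta>\<gamma>: "\<beta> \<ge> 0" "\<gamma> \<ge> 0"
    and semigroup: "contraction_C0_semigroup_on (H0 a) (H0_norm a \<beta> \<gamma>) S"
    and generator: "is_generator_on (H0 a) (H0_norm a \<beta> \<gamma>) S (dom_calA_nd a \<beta> \<gamma>) (calA_nd a)"
    and stable: "M > 0" "\<omega> > 0"
      "\<forall>t\<ge>0. onorm_on (H0 a) (H0_norm a \<beta> \<gamma>) (H0_norm a \<beta> \<gamma>) (S t) \<le> M * exp (- \<omega> * t)"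
    and tau: "\<tau> > 0"
    and k_loc: "\<forall>t\<ge>-\<tau>. set_integrable lebesgue {-\<tau>..t} k"
    and k_bound: "\<Lambda> > 0" "\<forall>t\<ge>0. (LINT s:{t - \<tau>..t}|lebesgue. \<bar>k s\<bar>) \<le> \<Lambda>"
    and B: "bounded_linear_on UNIV norm (L2w a) (L2w_norm a) B"
    and Bs: "is_adjoint a B Bs"
    and b: "b = onorm_on UNIV norm (L2w_norm a) B"
    and f_maps: "\<forall>u\<in>H2w0 a. f u \<in> L2w a"
    and f_cont: "\<forall>u\<in>H2w0 a. \<forall>\<epsilon>>0. \<exists>\<delta>>0. \<forall>v\<in>H2w0 a.
      L2_norm ((wderiv ^^ 2) v - (wderiv ^^ 2) u) < \<delta> \<longrightarrow> L2w_norm a (f v - f u) < \<epsilon>"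
    and f_zero: "f 0 = 0"
    and f_lip: "\<forall>r>0. L r > 0 \<and> (\<forall>u\<in>H2w0 a. \<forall>v\<in>H2w0 a.
      L2_norm ((wderiv ^^ 2) u) \<le> r \<longrightarrow> L2_norm ((wderiv ^^ 2) v) \<le> r \<longrightarrow>
      L2w_norm a (f u - f v) \<le> L r * L2_norm ((wderiv ^^ 2) u - (wderiv ^^ 2) v))"
    and h: "strict_mono_on {0..} h" "continuous_on {0..} h" "\<forall>x\<ge>0. h x \<ge> 0"
    and f_h: "\<forall>u\<in>H2w0 a. L2w_inner a (f u) u
      \<le> h (L2_norm ((wderiv ^^ 2) u)) * (L2_norm ((wderiv ^^ 2) u))\<^sup>2"
    and alpha: "\<alpha> \<ge> 0" "0 \<le> \<omega>'" "\<omega>' < \<omega>"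
      "\<forall>t>0. M * b\<^sup>2 * exp (\<omega> * \<tau>) * (LINT s:{0..t}|lebesgue. \<bar>k (s + \<tau>)\<bar>) \<le> \<alpha> + \<omega>' * t"
    and radius: "T > 0" "\<rho> > 0" "C\<rho> > 0" "L C\<rho> < (\<omega> - \<omega>') / M"
    and well_posed: "\<forall>Z0 g'. small_data a \<beta> \<gamma> \<tau> k \<rho> Z0 g' \<longrightarrow>
      (\<exists>Z. mild_solution a \<beta> \<gamma> S \<tau> k B Bs f Z0 g' T Z \<and>
           (\<forall>Z'. mild_solution a \<beta> \<gamma> S \<tau> k B Bs f Z0 g' T Z' \<longrightarrow> (\<forall>t\<in>{0..<T}. Z' t = Z t)) \<and>
           (\<forall>t\<in>{0..<T}. H0_norm a \<beta> \<gamma> (Z t) \<le> C\<rho>))"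
    and data: "small_data a \<beta> \<gamma> \<tau> k \<rho> Y0 g"
  shows "\<forall>Y. mild_solution a \<beta> \<gamma> S \<tau> k B Bs f Y0 g T Y \<longrightarrow>
    (\<forall>t\<in>{0..<T}. H0_norm a \<beta> \<gamma> (Y t) \<le>
       M * exp \<alpha> *
       (H0_norm a \<beta> \<gamma> Y0 +
        (LINT s:{0..\<tau>}|lebesgue. exp (\<omega> * s) * \<bar>k s\<bar> * H0_norm a \<beta> \<gamma> (psi B g (s - \<tau>)))) *
       exp (- (\<omega> - \<omega>' - M * L C\<rho>) * t))"
proof (intro allI impI ballI)
  fix Y t
  assume Y: "mild_solution a \<beta> \<gamma> S \<tau> k B Bs f Y0 g T Y" and t: "t \<in> {0..<T}"
  interpret weight a by (rule weight_WD_SD[OF a])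
  let ?N = "H0_norm a \<beta> \<gamma>"
  interpret H: seminorm_on "H0 a" ?N by (rule seminorm_H0[OF \<beta>\<gamma>])
  interpret w: seminorm_on "L2w a" "L2w_norm a" by (rule seminorm_L2w)
  interpret one: seminorm_on L2 "L2w_norm (\<lambda>_. 1)"
    using unit_weight.seminorm_L2w by (simp add: L2w_unit)

  have Y_H0: "Y s \<in> H0 a" if "s \<in> {0..<T}" for s
    using Y that by (simp add: mild_solution_def)
  have Y_bound: "?N (Y s) \<le> C\<rho>" if s: "s \<in> {0..<T}" for s
  proof -
    obtain Z where "\<forall>Z'. mild_solution a \<beta> \<gamma> S \<tau> k B Bs f Y0 g T Z' \<longrightarrow> (\<forall>t\<in>{0..<T}. Z' t = Z t)"
      "\<forall>t\<in>{0..<T}. ?N (Z t) \<le> C\<rho>"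
      using well_posed data by blast
    then show ?thesis using Y s by simp
  qed
  have Y_cont: "continuous_on {0..<T} (\<lambda>s. ?N (Y s))"
    unfolding continuous_on_def
  proof
    fix r assume r: "r \<in> {0..<T}"
    have "((\<lambda>s. ?N (Y s - Y r)) \<longlongrightarrow> 0) (at r within {0..<T})"
      using Y r by (simp add: mild_solution_def)
    then have "((\<lambda>s. ?N (Y s) - ?N (Y r)) \<longlongrightarrow> 0) (at r within {0..<T})"
    proof (rule Lim_null_comparison[rotated])
      show "\<forall>\<^sub>F s in at r within {0..<T}. norm (?N (Y s) - ?N (Y r)) \<le> ?N (Y s - Y r)"
        unfolding eventually_at_filter
        using H.abs_diff_le[OF Y_H0 Y_H0[OF r]] by (auto intro!: always_eventually)
    qed
    then show "((\<lambda>s. ?N (Y s)) \<longlongrightarrow> ?N (Y r)) (at r within {0..<T})"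
      by (rule LIM_zero_cancel)
  qed

  have S_H0: "S r X \<in> H0 a" and S_bound: "?N (S r X) \<le> M * exp (- \<omega> * r) * ?N X"
    if "0 \<le> r" "X \<in> H0 a" for r X
  proof -
    have bl: "bounded_linear_on (H0 a) ?N (H0 a) ?N (S r)"
      using semigroup that by (simp add: contraction_C0_semigroup_on_def C0_semigroup_on_def)
    then show "S r X \<in> H0 a" using that by (simp add: bounded_linear_on_def)
    have "?N (S r X) \<le> onorm_on (H0 a) ?N ?N (S r) * ?N X"
      by (rule onorm_on_bound[OF bl H.nonneg that(2)])
    also have "\<dots> \<le> M * exp (- \<omega> * r) * ?N X"
      using stable(3) that H.nonneg by (intro mult_right_mono) auto
    finally show "?N (S r X) \<le> M * exp (- \<omega> * r) * ?N X" .
  qed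

  have BW: "B x \<in> L2w a" for x using B by (auto simp: bounded_linear_on_def)
  have H0_0: "(0, v) \<in> H0 a" if "v \<in> L2w a" for v
    using that subspace_0[OF subspace_H2w0] by (simp add: H0_def)
  define p where "p s = ?N (psi B g (s - \<tau>))" for s
  have p_eq: "p s = L2w_norm a (B (g (s - \<tau>)))" for s
    by (simp add: p_def psi_def H0_norm_Pair_zero)
  have p_nonneg: "0 \<le> p s" for s using w.nonneg[OF BW] by (simp add: p_eq)
  define P where "P = (LINT s:{0..\<tau>}|lebesgue. exp (\<omega> * s) * \<bar>k s\<bar> * p s)"
  \<comment> \<open>The history part of the memory, extended by 0 so that it can be added to the
    shifted part on the whole line.\<close>
  define E where "E s = indicator {0..\<tau>} s *\<^sub>R (exp (\<omega> * s) * \<bar>k s\<bar> * p s)" for s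
  have E_nonneg: "0 \<le> E s" for s using p_nonneg by (simp add: E_def)
  have k_int: "set_integrable lebesgue {c..d} k" if "- \<tau> \<le> c" for c d
  proof (cases "d \<ge> - \<tau>")
    case True
    then show ?thesis
      using k_loc that by (rule_tac absolutely_integrable_on_subinterval[where S="{-\<tau>..d}"]) auto
  next
    case False
    then show ?thesis using that by (simp add: set_integrable_def)
  qed
  have "set_integrable lebesgue {0..\<tau>} (\<lambda>s. exp (\<omega> * s) * \<bar>k s\<bar> * p s)"
    unfolding p_eq using data tau
    by (intro memory_integrable[where C=b and n="\<lambda>x. L2w_norm a (B x)"] k_int L2w_norm_B_continuous[OF B]
        w.nonneg BW continuous_intros)
      (auto simp: small_data_def b intro!: onorm_on_bound[OF B])
  then have E_int: "integrable lebesgue E" and E_P: "(LINT s|lebesgue. E s) = P"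
    unfolding set_integrable_def set_lebesgue_integral_def P_def E_def[abs_def] by simp_all
  have P_nonneg: "0 \<le> P"
    unfolding E_P[symmetric] using E_nonneg by (intro integral_nonneg_AE) auto

  define \<phi> where "\<phi> s = exp (\<omega> * s) * ?N (Y s)" for s
  \<comment> \<open>After the shift by \<open>\<tau>\<close> the weight exp(\<omega> (s + \<tau>))
    splits into exp(\<omega> \<tau>), kept in the kernel, and exp(\<omega> s), absorbed by
    \<open>\<phi>\<close>.\<close>
  define \<kappa>0 where "\<kappa>0 s = b\<^sup>2 * exp (\<omega> * \<tau>) * \<bar>k (s + \<tau>)\<bar>" for s
  define \<kappa> where "\<kappa> s = M * \<kappa>0 s + M * L C\<rho>" for s
  define A where "A = M * (?N Y0 + P)"
  have LC: "0 < L C\<rho>" using f_lip radius by blast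
  have Y0: "Y0 \<in> H0 a" using data by (simp add: small_data_def)
  have A_nonneg: "0 \<le> A" using stable P_nonneg H.nonneg[OF Y0] by (simp add: A_def)
  have \<phi>_cont: "continuous_on {0..<T} \<phi>"
    unfolding \<phi>_def[abs_def] by (intro continuous_intros Y_cont)
  have \<phi>_nonneg: "0 \<le> \<phi> s" if "s \<in> {0..<T}" for s
    using H.nonneg[OF Y_H0[OF that]] by (simp add: \<phi>_def)
  have \<kappa>0_nonneg: "0 \<le> \<kappa>0 s" for s by (simp add: \<kappa>0_def)
  have k_shift: "set_integrable lebesgue {0..d} (\<lambda>s. \<bar>k (s + \<tau>)\<bar>)" for d
    using tau by (intro set_integrable_abs set_integrable_lebesgue_shift k_int) auto
  then have \<kappa>0_int: "set_integrable lebesgue {0..d} \<kappa>0" for d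
    unfolding \<kappa>0_def[abs_def] by (rule set_integrable_mult_right)
  have const_int: "set_integrable lebesgue {0..d} (\<lambda>s. c::real)" for c d :: real
    by (intro absolutely_integrable_continuous_real continuous_on_const)
  have \<kappa>_int: "set_integrable lebesgue {0..d} \<kappa>" for d
    unfolding \<kappa>_def[abs_def] by (intro set_integral_add(1) set_integrable_mult_right \<kappa>0_int const_int)
  have prod_int: "set_integrable lebesgue {0..r} (\<lambda>s. q s * \<phi> s)"
    if r: "r \<in> {0..<T}" and q: "set_integrable lebesgue {0..r} q" for q r
  proof -
    have c: "continuous_on {0..r} \<phi>" using r by (intro continuous_on_subset[OF \<phi>_cont]) auto
    have "set_integrable lebesgue {0..r} (\<lambda>s. \<phi> s * q s)"
      using c q by (intro absolutely_integrable_bounded_measurable_product_real)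
        (auto intro!: continuous_imp_measurable_on_sets_lebesgue compact_imp_bounded compact_continuous_image)
    then show ?thesis by (simp add: mult.commute)
  qed

  have BBs: "?N (calB B Bs X) \<le> b\<^sup>2 * ?N X" if "X \<in> H0 a" for X
  proof -
    have "?N (calB B Bs X) = L2w_norm a (B (Bs (snd X)))"
      by (simp add: calB_def H0_norm_Pair_zero)
    also have "\<dots> \<le> b\<^sup>2 * L2w_norm a (snd X)"
      unfolding b using that by (intro BBs_bound[OF B Bs]) (auto simp: H0_def)
    also have "\<dots> \<le> b\<^sup>2 * ?N X"
      using H0_norm_components(2)[OF that \<beta>\<gamma>] by (intro mult_left_mono) auto
    finally show ?thesis .
  qed
  have f_bound: "?N (calF f (Y s)) \<le> L C\<rho> * ?N (Y s)" and f_H0: "calF f (Y s) \<in> H0 a"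
    if s: "s \<in> {0..<T}" for s
  proof -
    let ?u = "fst (Y s)"
    have u: "?u \<in> H2w0 a" using Y_H0[OF s] by (auto simp: H0_def)
    show "calF f (Y s) \<in> H0 a"
      using f_maps u by (simp add: calF_def H0_0)
    have D0: "(wderiv ^^ 2) 0 = 0" by (simp add: numeral_2_eq_2 wderiv_zero)
    have L0: "L2_norm 0 = 0"
      using one.zero by (simp add: L2_norm_def L2w_norm_def L2w_inner_def power2_eq_square)
    have le: "L2_norm ((wderiv ^^ 2) ?u) \<le> ?N (Y s)"
      by (rule H0_norm_components(1)[OF Y_H0[OF s] \<beta>\<gamma>])
    have "?N (calF f (Y s)) = L2w_norm a (f ?u - f 0)"
      by (simp add: calF_def H0_norm_Pair_zero f_zero)
    also have "\<dots> \<le> L C\<rho> * L2_norm ((wderiv ^^ 2) ?u - (wderiv ^^ 2) 0)"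
      using f_lip radius(3) u subspace_0[OF subspace_H2w0] le Y_bound[OF s] L0 D0 by force
    also have "\<dots> \<le> L C\<rho> * ?N (Y s)"
      using le LC by (simp add: D0)
    finally show "?N (calF f (Y s)) \<le> L C\<rho> * ?N (Y s)" .
  qed

  have main: "\<phi> r \<le> A + integral {0..r} (\<lambda>s. \<kappa> s * \<phi> s)" if r: "r \<in> {0..<T}" for r
  proof -
    let ?h = "\<lambda>s. calB_hist B Bs g Y (s - \<tau>)"
    obtain I J where
      I: "has_bochner_integral_on (H0 a) ?N (lebesgue_on {0..r}) (\<lambda>s. S (r - s) (k s *\<^sub>R ?h s)) I" and
      J: "has_bochner_integral_on (H0 a) ?N (lebesgue_on {0..r}) (\<lambda>s. S (r - s) (calF f (Y s))) J" and
      Yr: "Y r = S r Y0 - I + J"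
      using Y r unfolding mild_solution_def by blast
    have IJ: "I \<in> H0 a" "J \<in> H0 a" using I J by (auto simp: has_bochner_integral_on_def)

    \<comment> \<open>The part of the memory coming from the solution itself is D (s - \<tau>). Only
      arguments up to r - \<tau> occur; keeping all of {0..r} merely enlarges a nonnegative bound
      and spares a distinction between r < \<tau> and r \<ge> \<tau>.\<close>
    define D where "D s = indicator {0..r} s *\<^sub>R (\<kappa>0 s * \<phi> s)" for s
    have D_int: "integrable lebesgue D"
      using prod_int[OF r \<kappa>0_int] unfolding set_integrable_def D_def[abs_def] .
    have D_nonneg: "0 \<le> D s" for s
      using \<kappa>0_nonneg \<phi>_nonneg r by (auto simp: D_def indicator_def)
    have D_shift: "integrable lebesgue (\<lambda>s. D (s - \<tau>))"
      "(LINT s|lebesgue. D (s - \<tau>)) = (LINT s|lebesgue. D s)"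
      using D_int lebesgue_integrable_real_affine_iff[of 1 D "- \<tau>"] lebesgue_integral_real_affine[of 1 D "- \<tau>"]
      by simp_all
    \<comment> \<open>\<open>E\<close> dominates the integrand for s \<le> \<tau> and the shifted
      \<open>D\<close> for s > \<tau>; by nonnegativity their sum dominates it everywhere.\<close>
    define G where "G s = M * exp (- \<omega> * r) * (E s + D (s - \<tau>))" for s
    have G_int: "integrable lebesgue G"
      unfolding G_def[abs_def] using E_int D_shift by auto
    have G_nonneg: "0 \<le> G s" for s
      using stable E_nonneg D_nonneg by (simp add: G_def)
    have h_bound: "?h s \<in> H0 a" "exp (\<omega> * s) * \<bar>k s\<bar> * ?N (?h s) \<le> E s + D (s - \<tau>)"
      if s: "s \<in> {0..r}" for s
    proof -
      show "?h s \<in> H0 a" using BW H0_0 by (simp add: calB_hist_def psi_def calB_def)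
      show "exp (\<omega> * s) * \<bar>k s\<bar> * ?N (?h s) \<le> E s + D (s - \<tau>)"
      proof (cases "s \<le> \<tau>")
        case True
        then have "exp (\<omega> * s) * \<bar>k s\<bar> * ?N (?h s) = E s"
          using s by (simp add: calB_hist_def E_def p_def)
        then show ?thesis using D_nonneg by simp
      next
        case False
        then have s': "s - \<tau> \<in> {0..<T}" "s - \<tau> \<in> {0..r}" using s r tau by auto
        have "exp (\<omega> * s) * \<bar>k s\<bar> * ?N (?h s) \<le> exp (\<omega> * s) * \<bar>k s\<bar> * (b\<^sup>2 * ?N (Y (s - \<tau>)))"
          using False BBs[OF Y_H0[OF s'(1)]] by (intro mult_left_mono) (auto simp: calB_hist_def)
        also have "\<dots> = D (s - \<tau>)"
          using s' by (simp add: D_def \<kappa>0_def \<phi>_def algebra_simps exp_diff)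
        finally show ?thesis using E_nonneg[of s] by simp
      qed
    qed
    have "?N I \<le> (LINT s|lebesgue_on {0..r}. G s)"
    proof (rule H.has_bochner_integral_on_bound[OF I])
      show "integrable (lebesgue_on {0..r}) G" by (rule integral_lebesgue_on_le[OF G_int G_nonneg]) simp
      fix s assume "s \<in> space (lebesgue_on {0..r})"
      then have s: "s \<in> {0..r}" by simp
      have "?N (S (r - s) (k s *\<^sub>R ?h s)) \<le> M * exp (- \<omega> * (r - s)) * ?N (k s *\<^sub>R ?h s)"
        using s h_bound(1) by (intro S_bound subspace_scale[OF subspace_H0]) auto
      \<comment> \<open>The decay exp(- \<omega> (r - s)) of the semigroup factors, so the
        dependence on r leaves the integral and the rest is the weight of
        \<open>\<phi>\<close>.\<close>
      also have "\<dots> = M * exp (- \<omega> * r) * (exp (\<omega> * s) * \<bar>k s\<bar> * ?N (?h s))"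
        using H.scale[OF h_bound(1)[OF s]] by (simp add: algebra_simps exp_diff exp_minus divide_inverse)
      also have "\<dots> \<le> G s"
        unfolding G_def using h_bound(2)[OF s] stable by (intro mult_left_mono) auto
      finally show "?N (S (r - s) (k s *\<^sub>R ?h s)) \<le> G s" .
    qed
    also have "\<dots> \<le> (LINT s|lebesgue. G s)"
      by (rule integral_lebesgue_on_le[OF G_int G_nonneg]) simp
    also have "\<dots> = M * exp (- \<omega> * r) * (P + (LINT s|lebesgue. D s))"
      unfolding G_def[abs_def] using E_int D_shift E_P by simp
    also have "(LINT s|lebesgue. D s) = integral {0..r} (\<lambda>s. \<kappa>0 s * \<phi> s)"
      using set_lebesgue_integral_eq_integral(2)[OF prod_int[OF r \<kappa>0_int]]
      unfolding set_lebesgue_integral_def D_def[abs_def] .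
    finally have NI: "?N I \<le> M * exp (- \<omega> * r) * (P + integral {0..r} (\<lambda>s. \<kappa>0 s * \<phi> s))" .

    have one_int: "set_integrable lebesgue {0..r} \<phi>"
      using prod_int[OF r const_int[of r 1]] by simp
    have NJ: "?N J \<le> (LINT s|lebesgue_on {0..r}. M * exp (- \<omega> * r) * (L C\<rho> * \<phi> s))"
    proof (rule H.has_bochner_integral_on_bound[OF J])
      show "integrable (lebesgue_on {0..r}) (\<lambda>s. M * exp (- \<omega> * r) * (L C\<rho> * \<phi> s))"
        using one_int by (auto simp: integrable_restrict_space set_integrable_def)
      fix s assume "s \<in> space (lebesgue_on {0..r})"
      then have s: "s \<in> {0..r}" "s \<in> {0..<T}" using r by auto
      have "?N (S (r - s) (calF f (Y s))) \<le> M * exp (- \<omega> * (r - s)) * ?N (calF f (Y s))"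
        using s by (intro S_bound f_H0) auto
      also have "\<dots> \<le> M * exp (- \<omega> * (r - s)) * (L C\<rho> * ?N (Y s))"
        using f_bound[OF s(2)] stable by (intro mult_left_mono) auto
      also have "\<dots> = M * exp (- \<omega> * r) * (L C\<rho> * \<phi> s)"
        by (simp add: \<phi>_def algebra_simps exp_diff exp_minus divide_inverse)
      finally show "?N (S (r - s) (calF f (Y s))) \<le> M * exp (- \<omega> * r) * (L C\<rho> * \<phi> s)" .
    qed
    also have "\<dots> = M * exp (- \<omega> * r) * (L C\<rho> * (LINT s|lebesgue_on {0..r}. \<phi> s))"
      by simp
    also have "(LINT s|lebesgue_on {0..r}. \<phi> s) = integral {0..r} \<phi>"
      using one_int by (intro lebesgue_integral_eq_integral) (auto simp: integrable_restrict_space set_integrable_def)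
    finally have NJ: "?N J \<le> M * exp (- \<omega> * r) * (L C\<rho> * integral {0..r} \<phi>)" .

    have NS: "?N (S r Y0) \<le> M * exp (- \<omega> * r) * ?N Y0" and SV: "S r Y0 \<in> H0 a"
      using S_bound S_H0 r Y0 by auto
    have "?N (Y r) \<le> ?N (S r Y0) + ?N I + ?N J"
      unfolding Yr using H.triangle[OF subspace_diff[OF subspace_H0 SV IJ(1)] IJ(2)]
        H.triangle_minus[OF SV IJ(1)] by simp
    also have "\<dots> \<le> M * exp (- \<omega> * r) * (?N Y0 + (P + integral {0..r} (\<lambda>s. \<kappa>0 s * \<phi> s)) + L C\<rho> * integral {0..r} \<phi>)"
      using NS NI NJ by (simp only: distrib_left)
    finally have "exp (\<omega> * r) * ?N (Y r) \<le> exp (\<omega> * r) * (M * exp (- \<omega> * r) *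
        (?N Y0 + (P + integral {0..r} (\<lambda>s. \<kappa>0 s * \<phi> s)) + L C\<rho> * integral {0..r} \<phi>))"
      by (rule mult_left_mono) simp
    also have "\<dots> = exp (\<omega> * r) * exp (- \<omega> * r) * (A + (M * integral {0..r} (\<lambda>s. \<kappa>0 s * \<phi> s) + M * L C\<rho> * integral {0..r} \<phi>))"
      unfolding A_def by (simp add: algebra_simps)
    also have "exp (\<omega> * r) * exp (- \<omega> * r) = 1"
      by (simp flip: exp_add)
    also have "M * integral {0..r} (\<lambda>s. \<kappa>0 s * \<phi> s) + M * L C\<rho> * integral {0..r} \<phi>
        = integral {0..r} (\<lambda>s. M * (\<kappa>0 s * \<phi> s) + M * L C\<rho> * \<phi> s)"
      using set_lebesgue_integral_eq_integral(1)[OF prod_int[OF r \<kappa>0_int]]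
        set_lebesgue_integral_eq_integral(1)[OF one_int]
      by (subst Henstock_Kurzweil_Integration.integral_add)
        (auto intro: integrable_on_mult_right)
    also have "\<dots> = integral {0..r} (\<lambda>s. \<kappa> s * \<phi> s)"
      by (simp add: \<kappa>_def algebra_simps)
    finally show ?thesis by (simp add: \<phi>_def)
  qed

  have "\<phi> t \<le> A * exp (integral {0..t} \<kappa>)"
  proof (rule Gronwall_integrable_kernel)
    show "continuous_on {0..t} \<phi>" using t by (intro continuous_on_subset[OF \<phi>_cont]) auto
    show "0 \<le> \<kappa> s" for s
      using \<kappa>0_nonneg stable LC by (simp add: \<kappa>_def)
  qed (use t A_nonneg \<kappa>_int \<phi>_nonneg main in auto)
  also have "integral {0..t} \<kappa> \<le> \<alpha> + \<omega>' * t + M * L C\<rho> * t"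
  \<comment> \<open>The bound on the mass of k is available for t > 0; at t = 0 the claim is 0 \<le>
    \<open>\<alpha>\<close>.\<close>
  proof (cases "t = 0")
    case True
    then show ?thesis using alpha by simp
  next
    case False
    then have t0: "0 < t" using t by simp
    have "(\<kappa> has_integral (M * integral {0..t} \<kappa>0 + M * L C\<rho> * t)) {0..t}"
      unfolding \<kappa>_def[abs_def]
      using set_lebesgue_integral_eq_integral(1)[OF \<kappa>0_int[of t]] has_integral_const_real[of "M * L C\<rho>" 0 t] t0
      by (intro has_integral_add has_integral_mult_right integrable_integral) (auto simp: mult.commute)
    then have "integral {0..t} \<kappa> = M * integral {0..t} \<kappa>0 + M * L C\<rho> * t"
      by (rule integral_unique)
    moreover have "integral {0..t} \<kappa>0 = b\<^sup>2 * exp (\<omega> * \<tau>) * (LINT s:{0..t}|lebesgue. \<bar>k (s + \<tau>)\<bar>)"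
      unfolding \<kappa>0_def[abs_def] set_lebesgue_integral_eq_integral(2)[OF k_shift] by simp
    ultimately show ?thesis using alpha(4) t0 by (simp add: mult.assoc)
  qed
  finally have "\<phi> t \<le> A * exp (\<alpha> + \<omega>' * t + M * L C\<rho> * t)"
    using A_nonneg by (simp add: mult_left_mono)
  \<comment> \<open>Removing the weight combines - \<omega> with \<omega>' and M L(C\<rho>) into the
    final rate, while exp \<alpha> remains as a constant.\<close>
  then have "exp (- \<omega> * t) * \<phi> t \<le> exp (- \<omega> * t) * (A * exp (\<alpha> + \<omega>' * t + M * L C\<rho> * t))"
    by (rule mult_left_mono) simp
  moreover have "exp (- \<omega> * t) * \<phi> t = ?N (Y t)"
    by (simp add: \<phi>_def mult.assoc[symmetric] flip: exp_add)
  moreover have "exp (- \<omega> * t) * (A * exp (\<alpha> + \<omega>' * t + M * L C\<rho> * t))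
      = M * exp \<alpha> * (?N Y0 + P) * exp (- (\<omega> - \<omega>' - M * L C\<rho>) * t)"
  proof -
    have "exp (- \<omega> * t) * exp (\<alpha> + \<omega>' * t + M * L C\<rho> * t) = exp \<alpha> * exp (- (\<omega> - \<omega>' - M * L C\<rho>) * t)"
      unfolding exp_add[symmetric] by (simp add: algebra_simps)
    then show ?thesis unfolding A_def by (simp add: ac_simps)
  qed
  ultimately have "?N (Y t) \<le> M * exp \<alpha> * (?N Y0 + P) * exp (- (\<omega> - \<omega>' - M * L C\<rho>) * t)"
    by (simp only:)
  then show "?N (Y t) \<le> M * exp \<alpha> *
      (?N Y0 + (LINT s:{0..\<tau>}|lebesgue. exp (\<omega> * s) * \<bar>k s\<bar> * ?N (psi B g (s - \<tau>)))) *
      exp (- (\<omega> - \<omega>' - M * L C\<rho>) * t)"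
    unfolding P_def p_def .
qed

end
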